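(* Let $\mathcal{V}(\cdot)=\mathbb{E}[v(\cdot)]$, where $v=\phi^*$, let $\Phi(p)=\mathbb{E}[\phi(p)]$, $M_N\in\mathcal{M}$, $\sigma>0$ and $\varepsilon\ge0$. If a variational density $\bar p\in\mathcal{L}$ exists for the generalized variational inference (GVI) problem $$\sup_{p\in\mathfrak{D}}\{\mathbb{E}[pM_N]-\sigma\mathbb{E}[\phi(p)]\},$$ then it satisfies (for $\Pi$-a.e. $\theta$) $$\bar p(\theta)\in\partial v(\sigma^{-1}(M_N(\theta)-\bar t)),$$ where $\bar t$ solves the problem $\min_{t\in\mathbb{R}}\{t+\sigma\mathcal{V}(\sigma^{-1}(M_N-t))\}$. On the other hand, if a variational density $\bar p\in\mathcal{L}$ exists for the coherent GVI (CGVI) problem $$\sup_{p\in\mathfrak{D}}\{\mathbb{E}[pM_N]\;:\;\mathbb{E}[\phi(p)]\le\varepsilon\},$$ then it satisfies (for $\Pi$-a.e. $\theta$) $$\bar p(\theta)\in\partial v(\bar\lambda^{-1}(M_N(\theta)-\bar\mu)),$$ where $(\bar\lambda,\bar\mu)$ solves the problem $\min_{\mu\in\mathbb{R},\,\lambda\ge0}\{\mu+\lambda\varepsilon+(\lambda\Phi)^*(M_N-\mu)\}$.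
   Context: $(\Theta,\mathcal{B},\Pi)$ is a complete probability space, $\mathbb{E}$ is expectation with respect to $\Pi$, and $\mathfrak{D}$ is the set of $\mathcal{B}$-measurable $p:\Theta\to[0,\infty]$ with $\mathbb{E}[p]=1$. $\phi:\mathbb{R}\to[0,+\infty]$ is proper, closed and convex with $\phi(1)=0$ and $\phi(t)=+\infty$ for $t<0$. Its Fenchel conjugate $v=\phi^*$ is a risk-averse disutility function: convex, increasing (in the weak sense), $v(x)\ge x$ for all $x\in\mathbb{R}$, $v(x)=x$ implies $x=0$, and $v(0)=0$; moreover $v(t)<+\infty$ for some $t>0$. Set $\psi(x)=v^\#(x)=\sup_{t\ge0}\{tx-v(t)\}$ and $\psi^\#(t)=\sup_{x\ge0}\{tx-\psi(x)\}$ (which equals $v(t)$ for $t\ge0$). For such a function $g$, the Orlicz space $L_g$ consists of the (a.s. equivalence classes of) $\mathcal{B}$-measurable $X$ with $\mathbb{E}[g(|X/a|)]<\infty$ for some $a>0$, with Luxemburg norm $\inf\{a>0:\mathbb{E}[g(|X/a|)]\le1\}$. Take $\mathcal{L}=L_\psi$ and $\mathcal{M}=L_{\psi^\#}$, paired by $\langle p,X\rangle=\mathbb{E}[pX]$. A variational density is a maximizer of the respective problem. $M_N(\theta)=\frac1N\sum_{n=1}^Nm(\theta,y_n)$ is the pay-off function for fixed data $y_1,\dots,y_N$ in a data space $\Upsilon$ and a function $m:\Theta\times\Upsilon\to\mathbb{R}$. For $\lambda\ge0$, $(\lambda\Phi)^*$ is the Fenchel conjugate of $\lambda\Phi$, i.e.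 $(\lambda\Phi)^*(X)=\sup_{p\in\mathcal{L}}\{\mathbb{E}[pX]-\lambda\Phi(p)\}$ for $X\in\mathcal{M}$, where $0\cdot(+\infty)=+\infty$. $\partial v$ is the convex subdifferential of $v$ on $\mathbb{R}$.
   Formalization: For CGVI, the inclusion is stated for every dual solution with λ̄ > 0 (λ̄⁻¹ is undefined when λ̄ = 0, which can be the only solution), and existence of a dual solution is claimed only for ε > 0, since for ε = 0 the minimum need not be attained. *)

theory Defs
  imports "HOL-Probability.Probability"
begin

definition epi :: "(real \<Rightarrow> ereal) \<Rightarrow> (real \<times> real) set" where
  "epi f = {(x, r). f x \<le> ereal r}"

definition proper_closed_convex :: "(real \<Rightarrow> ereal) \<Rightarrow> bool" where
  "proper_closed_convex f \<longleftrightarrow>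
     (\<exists>x. f x < \<infinity>) \<and> (\<forall>x. f x > -\<infinity>) \<and> closed (epi f) \<and> convex (epi f)"

definition fenchel_conj :: "(real \<Rightarrow> ereal) \<Rightarrow> real \<Rightarrow> ereal" where
  "fenchel_conj f x = (SUP t. ereal (t * x) - f t)"

definition monotone_conj :: "(real \<Rightarrow> ereal) \<Rightarrow> real \<Rightarrow> ereal" where
  "monotone_conj f x = (SUP t\<in>{0..}. ereal (t * x) - f t)"

text \<open>For a function that is finite somewhere, this is empty at points where the value is
  \<open>\<infinity>\<close>.\<close>

definition subdifferential :: "(real \<Rightarrow> ereal) \<Rightarrow> real \<Rightarrow> real set" where
  "subdifferential f x = {s. \<forall>y. f x + ereal (s * (y - x)) \<le> f y}"

definition risk_averse_disutility :: "(real \<Rightarrow> ereal) \<Rightarrow> bool" where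
  "risk_averse_disutility v \<longleftrightarrow>
     convex (epi v) \<and> mono v \<and> (\<forall>x. ereal x \<le> v x) \<and> (\<forall>x. v x = ereal x \<longrightarrow> x = 0) \<and> v 0 = 0"

text \<open>The integral of the positive part minus that of the negative part. In all uses below the
  negative part is integrable, so the value of \<open>\<infinity> - \<infinity>\<close> is irrelevant.\<close>

definition ereal_expectation :: "'a measure \<Rightarrow> ('a \<Rightarrow> ereal) \<Rightarrow> ereal" where
  "ereal_expectation P X =
     enn2ereal (\<integral>\<^sup>+\<theta>. e2ennreal (X \<theta>) \<partial>P) - enn2ereal (\<integral>\<^sup>+\<theta>. e2ennreal (- X \<theta>) \<partial>P)"

text \<open>Orlicz spaces as sets of functions rather than of equivalence classes.\<close>

definition orlicz_space :: "'a measure \<Rightarrow> (real \<Rightarrow> ereal) \<Rightarrow> ('a \<Rightarrow> real) set" where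
  "orlicz_space P g =
     {X \<in> borel_measurable P. \<exists>a>0. ereal_expectation P (\<lambda>\<theta>. g \<bar>X \<theta> / a\<bar>) < \<infinity>}"

definition densities :: "'a measure \<Rightarrow> ('a \<Rightarrow> ennreal) set" where
  "densities P = {p \<in> borel_measurable P. (\<integral>\<^sup>+\<theta>. p \<theta> \<partial>P) = 1}"

text \<open>A density is finite almost everywhere, so passing to real values changes it only on a
  null set.\<close>

definition real_density :: "('a \<Rightarrow> ennreal) \<Rightarrow> 'a \<Rightarrow> real" where
  "real_density p = (\<lambda>\<theta>. enn2real (p \<theta>))"

definition pairing :: "'a measure \<Rightarrow> ('a \<Rightarrow> real) \<Rightarrow> ('a \<Rightarrow> real) \<Rightarrow> real" where
  "pairing P p X = (\<integral>\<theta>. p \<theta> * X \<theta> \<partial>P)"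

definition divergence :: "'a measure \<Rightarrow> (real \<Rightarrow> ereal) \<Rightarrow> ('a \<Rightarrow> real) \<Rightarrow> ereal" where
  "divergence P \<phi> p = ereal_expectation P (\<lambda>\<theta>. \<phi> (p \<theta>))"

abbreviation L_space :: "'a measure \<Rightarrow> (real \<Rightarrow> ereal) \<Rightarrow> ('a \<Rightarrow> real) set" where
  "L_space P \<phi> \<equiv> orlicz_space P (monotone_conj (fenchel_conj \<phi>))"

abbreviation M_space :: "'a measure \<Rightarrow> (real \<Rightarrow> ereal) \<Rightarrow> ('a \<Rightarrow> real) set" where
  "M_space P \<phi> \<equiv> orlicz_space P (monotone_conj (monotone_conj (fenchel_conj \<phi>)))"

definition payoff :: "('a \<Rightarrow> 'y \<Rightarrow> real) \<Rightarrow> (nat \<Rightarrow> 'y) \<Rightarrow> nat \<Rightarrow> 'a \<Rightarrow> real" where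
  "payoff m y N \<theta> = (1 / real N) * (\<Sum>n=1..N. m \<theta> (y n))"

text \<open>If \<open>X \<in> M_space P \<phi>\<close> and the divergence of \<open>p\<close> is finite, then \<open>p\<close> lies in
  \<open>L_space P \<phi>\<close> (as \<open>\<psi> \<le> \<phi>\<close>) and \<open>p * X\<close> is integrable. If the divergence is infinite, the
  objective is \<open>-\<infinity>\<close>, whether or not \<open>p * X\<close> is integrable.\<close>

definition gvi_objective ::
    "'a measure \<Rightarrow> (real \<Rightarrow> ereal) \<Rightarrow> real \<Rightarrow> ('a \<Rightarrow> real) \<Rightarrow> ('a \<Rightarrow> ennreal) \<Rightarrow> ereal" where
  "gvi_objective P \<phi> \<sigma> X p =
     ereal (pairing P (real_density p) X) - ereal \<sigma> * divergence P \<phi> (real_density p)"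

definition gvi_density ::
    "'a measure \<Rightarrow> (real \<Rightarrow> ereal) \<Rightarrow> real \<Rightarrow> ('a \<Rightarrow> real) \<Rightarrow> ('a \<Rightarrow> ennreal) \<Rightarrow> bool" where
  "gvi_density P \<phi> \<sigma> X p \<longleftrightarrow> is_arg_max (gvi_objective P \<phi> \<sigma> X) (\<lambda>q. q \<in> densities P) p"

definition cgvi_density ::
    "'a measure \<Rightarrow> (real \<Rightarrow> ereal) \<Rightarrow> real \<Rightarrow> ('a \<Rightarrow> real) \<Rightarrow> ('a \<Rightarrow> ennreal) \<Rightarrow> bool" where
  "cgvi_density P \<phi> \<epsilon> X p \<longleftrightarrow>
     is_arg_max (\<lambda>q. pairing P (real_density q) X)
       (\<lambda>q. q \<in> densities P \<and> divergence P \<phi> (real_density q) \<le> ereal \<epsilon>) p"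

definition gvi_dual ::
    "'a measure \<Rightarrow> (real \<Rightarrow> ereal) \<Rightarrow> real \<Rightarrow> ('a \<Rightarrow> real) \<Rightarrow> real \<Rightarrow> ereal" where
  "gvi_dual P v \<sigma> X t =
     ereal t + ereal \<sigma> * ereal_expectation P (\<lambda>\<theta>. v (inverse \<sigma> * (X \<theta> - t)))"

text \<open>Here \<open>0 \<cdot> \<infinity> = \<infinity>\<close>, in contrast to multiplication on \<^typ>\<open>ereal\<close>.\<close>

definition scale :: "real \<Rightarrow> ereal \<Rightarrow> ereal" where
  "scale l c = (if c = \<infinity> then \<infinity> else ereal l * c)"

definition scaled_divergence_conj ::
    "'a measure \<Rightarrow> (real \<Rightarrow> ereal) \<Rightarrow> real \<Rightarrow> ('a \<Rightarrow> real) \<Rightarrow> ereal" where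
  "scaled_divergence_conj P \<phi> l X =
     (SUP p\<in>L_space P \<phi>. ereal (pairing P p X) - scale l (divergence P \<phi> p))"

definition cgvi_dual ::
    "'a measure \<Rightarrow> (real \<Rightarrow> ereal) \<Rightarrow> real \<Rightarrow> ('a \<Rightarrow> real) \<Rightarrow> real \<times> real \<Rightarrow> ereal" where
  "cgvi_dual P \<phi> \<epsilon> X = (\<lambda>(l, \<mu>).
     ereal (\<mu> + l * \<epsilon>) + scaled_divergence_conj P \<phi> l (\<lambda>\<theta>. X \<theta> - \<mu>))"

end

theory Submission
  imports Defs
begin

text \<open>
  Both problems are concave programs over densities whose constraints are finite in number, so
  multipliers come from supporting lines of planar convex sets, such as the set of pairs of the mean
  and an achievable objective value. The assumption that \<open>v x > x\<close> for \<open>x \<noteq> 0\<close> makes \<open>1\<close> interior to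
  the domain of \<open>\<phi>\<close>, hence the mean constraint has a Slater point, and so does the divergence
  constraint when \<open>\<epsilon> > 0\<close>. With the multipliers the optimal density maximizes an
  integral functional without constraints, hence maximizes its integrand almost everywhere, and
  equality in the Fenchel-Young inequality is the claimed inclusion. Since the duality gap is zero,
  every dual minimizer satisfies this equality. For \<open>\<epsilon> = 0\<close> the dual need not attain its infimum,
  but letting the multiplier \<open>\<lambda>\<close> tend to infinity still shows that there is no gap.
\<close>

text \<open>Multiplier arguments need real Lagrangians, while the objectives and densities are
  extended-valued. The work is therefore done on \<open>admissible\<close>, where Young's inequality
  makes p * X integrable and normalization is an ordinary linear constraint. A GVI maximizer lies
  there because the density 1 already has a finite value. The two CGVI multipliers are found one
  after the other: \<lambda> with the mean held at 1, then \<mu> for the penalized problem. For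
  \<epsilon> = 0 both steps can fail. Feasible functions take values in the interval [a, b] of zeros
  of \<phi>, and if 1 is an endpoint of it, they equal 1 almost everywhere, so the mean constraint
  has no Slater point either. Near-optimal multipliers are then built in the opposite order: \<mu>
  for the support function of [a, b], possibly by letting it run off to infinity, and afterwards a
  large \<lambda>. This suffices, since a given dual minimizer only has to be compared with dual
  values within every \<delta> of the primal one.\<close>

section \<open>Supporting lines of planar convex sets\<close>

text \<open>A segment joining points on the two sides of \<open>c\<close> passes below (c, V), so no
  right chord from (c, V) is steeper than a left one. The supremum of the right slopes separates
  them; points on both sides make it finite, that is, exclude a vertical line.\<close>

lemma supporting_slope:
  fixes C :: "(real \<times> real) set"
  assumes C: "convex C"
    and top: "\<And>r. (c, r) \<in> C \<Longrightarrow> r \<le> V"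
    and left: "(s1, r1) \<in> C" "s1 < c"
    and right: "(s2, r2) \<in> C" "c < s2"
  obtains t where "\<And>s r. (s, r) \<in> C \<Longrightarrow> r \<le> V + t * (s - c)"
proof -
  have slopes: "(r' - V) / (s' - c) \<le> (V - r) / (c - s)"
    if "(s, r) \<in> C" "(s', r') \<in> C" "s < c" "c < s'" for s r s' r'
  proof -
    \<comment> \<open>The weight at which the segment crosses the vertical line through
      \<open>c\<close>.\<close>
    define u where "u = (c - s) / (s' - s)"
    have u: "0 \<le> u" "u \<le> 1" "u * (s' - s) = c - s"
      using that by (auto simp: u_def)
    have "(1 - u) *\<^sub>R (s, r) + u *\<^sub>R (s', r') \<in> C"
      using convexD[OF C that(1,2)] u by auto
    moreover have "(1 - u) * s + u * s' = c"
      using u(3) by (simp add: algebra_simps)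
    ultimately have "(1 - u) * r + u * r' \<le> V"
      using top by simp
    then have "(s' - s) * ((1 - u) * r + u * r') \<le> (s' - s) * V"
      using that by (intro mult_left_mono) auto
    also have "(s' - s) * ((1 - u) * r + u * r') = (s' - s) * r + (u * (s' - s)) * (r' - r)"
      by (simp add: algebra_simps)
    finally have "(r' - V) * (c - s) \<le> (V - r) * (s' - c)"
      unfolding u(3) by (simp add: algebra_simps)
    then show ?thesis
      using that by (simp add: frac_le_eq divide_simps mult.commute)
  qed
  define R where "R = {(r - V) / (s - c) | s r. (s, r) \<in> C \<and> c < s}"
  have R: "R \<noteq> {}" "bdd_above R"
    using right slopes[OF left(1) _ left(2)] by (auto simp: R_def bdd_above_def)
  show ?thesis
  proof
    fix s r assume sr: "(s, r) \<in> C"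
    consider "s < c" | "s = c" | "c < s" by linarith
    then show "r \<le> V + Sup R * (s - c)"
    proof cases
      case 1
      then have "Sup R \<le> (V - r) / (c - s)"
        using slopes[OF sr] by (intro cSup_least R(1)) (auto simp: R_def)
      then have "Sup R * (c - s) \<le> V - r"
        using 1 by (simp add: pos_le_divide_eq)
      then show ?thesis by (simp add: algebra_simps)
    next
      case 2
      then show ?thesis using top sr by simp
    next
      case 3
      then have "(r - V) / (s - c) \<le> Sup R"
        using sr by (intro cSup_upper R(2)) (auto simp: R_def)
      then have "r - V \<le> Sup R * (s - c)"
        using 3 by (simp add: pos_divide_le_eq)
      then show ?thesis by simp
    qed
  qed
qed

section \<open>Expectations of extended real functions\<close>

lemma ereal_expectation_cong_AE:
  assumes "AE \<theta> in P. Y \<theta> = Z \<theta>"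
  shows "ereal_expectation P Y = ereal_expectation P Z"
  unfolding ereal_expectation_def
  by (intro arg_cong2[where f = "(-)"] arg_cong[where f = enn2ereal] nn_integral_cong_AE)
    (use assms in auto)

lemma ereal_expectation_mono_AE:
  assumes "AE \<theta> in P. Y \<theta> \<le> Z \<theta>"
  shows "ereal_expectation P Y \<le> ereal_expectation P Z"
proof -
  have "(\<integral>\<^sup>+\<theta>. e2ennreal (Y \<theta>) \<partial>P) \<le> (\<integral>\<^sup>+\<theta>. e2ennreal (Z \<theta>) \<partial>P)"
    using assms by (intro nn_integral_mono_AE) (auto intro: e2ennreal_mono)
  moreover have "(\<integral>\<^sup>+\<theta>. e2ennreal (- Z \<theta>) \<partial>P) \<le> (\<integral>\<^sup>+\<theta>. e2ennreal (- Y \<theta>) \<partial>P)"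
    using assms by (intro nn_integral_mono_AE) (auto elim!: eventually_mono intro: e2ennreal_mono)
  ultimately show ?thesis
    unfolding ereal_expectation_def
    by (intro ereal_minus_mono) (simp_all add: less_eq_ennreal.rep_eq)
qed

lemma ereal_expectation_ereal:
  assumes "integrable P g"
  shows "ereal_expectation P (\<lambda>\<theta>. ereal (g \<theta>)) = ereal (\<integral>\<theta>. g \<theta> \<partial>P)"
proof -
  have "(\<integral>\<^sup>+\<theta>. ennreal (g \<theta>) \<partial>P) < \<infinity>" "(\<integral>\<^sup>+\<theta>. ennreal (- g \<theta>) \<partial>P) < \<infinity>"
    using assms unfolding real_integrable_def by (auto simp: top.not_eq_extremum)
  then obtain r r' where "0 \<le> r" "0 \<le> r'" "(\<integral>\<^sup>+\<theta>. ennreal (g \<theta>) \<partial>P) = ennreal r"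
    "(\<integral>\<^sup>+\<theta>. ennreal (- g \<theta>) \<partial>P) = ennreal r'"
    unfolding infinity_ennreal_def less_top_ennreal by blast
  then show ?thesis
    unfolding ereal_expectation_def real_lebesgue_integral_def[OF assms]
    by (simp add: enn2ereal_ennreal)
qed

lemma ereal_expectation_less_PInf_iff:
  assumes "\<And>\<theta>. 0 \<le> Y \<theta>"
  shows "ereal_expectation P Y < \<infinity> \<longleftrightarrow> (\<integral>\<^sup>+\<theta>. e2ennreal (Y \<theta>) \<partial>P) < \<infinity>"
proof -
  have "(\<integral>\<^sup>+\<theta>. e2ennreal (- Y \<theta>) \<partial>P) = 0"
    using assms by (simp add: e2ennreal_neg)
  then show ?thesis
    unfolding ereal_expectation_def
    by (cases "(\<integral>\<^sup>+\<theta>. e2ennreal (Y \<theta>) \<partial>P)") (auto simp: enn2ereal_ennreal zero_ennreal.rep_eq)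
qed

text \<open>A lower bound that is integrable rules out the ambiguous case \<open>\<infinity> - \<infinity>\<close>.\<close>

lemma ereal_expectation_le_imp_AE_eq:
  assumes g: "integrable P g" and Z[measurable]: "Z \<in> borel_measurable P"
    and le: "AE \<theta> in P. ereal (g \<theta>) \<le> Z \<theta>"
    and exp: "ereal_expectation P Z \<le> ereal (\<integral>\<theta>. g \<theta> \<partial>P)"
  shows "AE \<theta> in P. Z \<theta> = ereal (g \<theta>)"
proof -
  have g_meas[measurable]: "g \<in> borel_measurable P" using g by auto
  have "(\<integral>\<^sup>+\<theta>. e2ennreal (- Z \<theta>) \<partial>P) \<le> (\<integral>\<^sup>+\<theta>. e2ennreal (ereal (- g \<theta>)) \<partial>P)"
    using le by (intro nn_integral_mono_AE)
      (auto intro!: e2ennreal_mono simp: ereal_minus_le_minus simp flip: uminus_ereal.simps)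
  also have "\<dots> < \<infinity>"
    using g unfolding real_integrable_def by (auto simp: top.not_eq_extremum)
  finally have neg: "(\<integral>\<^sup>+\<theta>. e2ennreal (- Z \<theta>) \<partial>P) < \<infinity>" .
  have pos: "(\<integral>\<^sup>+\<theta>. e2ennreal (Z \<theta>) \<partial>P) < \<infinity>"
  proof (rule ccontr)
    assume "\<not> ?thesis"
    then have "ereal_expectation P Z = \<infinity>"
      using neg unfolding ereal_expectation_def
      by (cases "(\<integral>\<^sup>+\<theta>. e2ennreal (- Z \<theta>) \<partial>P)") (auto simp: less_top[symmetric] enn2ereal_ennreal top_ennreal.rep_eq)
    then show False using exp by simp
  qed
  have "AE \<theta> in P. e2ennreal (Z \<theta>) \<noteq> \<infinity>"
    using pos by (intro nn_integral_PInf_AE) auto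
  with le have fin: "AE \<theta> in P. Z \<theta> = ereal (real_of_ereal (Z \<theta>))"
  proof eventually_elim
    case (elim \<theta>)
    then show ?case by (cases "Z \<theta>") auto
  qed
  define h where "h = (\<lambda>\<theta>. real_of_ereal (Z \<theta>))"
  have [measurable]: "h \<in> borel_measurable P" by (simp add: h_def)
  have fin': "AE \<theta> in P. Z \<theta> = ereal (h \<theta>)" using fin by (simp add: h_def)
  have "(\<integral>\<^sup>+\<theta>. ennreal (h \<theta>) \<partial>P) = (\<integral>\<^sup>+\<theta>. e2ennreal (Z \<theta>) \<partial>P)"
    "(\<integral>\<^sup>+\<theta>. ennreal (- h \<theta>) \<partial>P) = (\<integral>\<^sup>+\<theta>. e2ennreal (- Z \<theta>) \<partial>P)"
    using fin' by (auto intro!: nn_integral_cong_AE)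
  with neg pos have h: "integrable P h"
    unfolding real_integrable_def by auto
  have "ereal (\<integral>\<theta>. h \<theta> \<partial>P) \<le> ereal (\<integral>\<theta>. g \<theta> \<partial>P)"
    using exp ereal_expectation_cong_AE[OF fin'] ereal_expectation_ereal[OF h] by simp
  then have "(\<integral>\<theta>. h \<theta> - g \<theta> \<partial>P) \<le> 0"
    using h g by simp
  moreover have nonneg: "AE \<theta> in P. 0 \<le> h \<theta> - g \<theta>"
    using fin' le by eventually_elim simp
  ultimately have "(\<integral>\<theta>. h \<theta> - g \<theta> \<partial>P) = 0"
    by (simp add: integral_nonneg_AE antisym)
  then have "AE \<theta> in P. h \<theta> - g \<theta> = 0"
    using integral_nonneg_eq_0_iff_AE[OF _ nonneg] h g by auto
  with fin' show ?thesis by eventually_elim simp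
qed

section \<open>The divergence generator and its conjugate\<close>

text \<open>Finiteness of the conjugate at some t > 0 is a growth condition on \<phi>: Young's
  inequality at t bounds s by (cost s + v t) / t. It makes the zero set of \<phi> bounded and
  functions of finite divergence integrable.\<close>

locale divergence_generator =
  fixes \<phi> :: "real \<Rightarrow> ereal"
  assumes proper_closed_convex: "proper_closed_convex \<phi>"
    and nonneg: "0 \<le> \<phi> t"
    and at_one: "\<phi> 1 = 0"
    and at_neg: "t < 0 \<Longrightarrow> \<phi> t = \<infinity>"
    and disutility: "risk_averse_disutility (fenchel_conj \<phi>)"
    and conj_finite_at_pos: "\<exists>t>0. fenchel_conj \<phi> t < \<infinity>"
begin

abbreviation v :: "real \<Rightarrow> ereal" where "v \<equiv> fenchel_conj \<phi>"

definition dom :: "real set" where "dom = {s. \<phi> s < \<infinity>}"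

text \<open>\<open>real_of_ereal\<close> sends \<infinity> to 0, so \<open>cost\<close> vanishes off
  \<open>dom\<close>. A zero of \<phi> is therefore always described by membership in
  \<open>dom\<close> together with zero cost.\<close>

definition cost :: "real \<Rightarrow> real" where "cost s = real_of_ereal (\<phi> s)"

lemma phi_eq_cost: "s \<in> dom \<Longrightarrow> \<phi> s = ereal (cost s)"
  using nonneg[of s] by (cases "\<phi> s") (auto simp: dom_def cost_def)

lemma cost_nonneg: "0 \<le> cost s"
  using nonneg by (simp add: cost_def real_of_ereal_pos)

lemma dom_nonneg: "s \<in> dom \<Longrightarrow> 0 \<le> s"
  using at_neg[of s] by (force simp: dom_def)

lemma one_in_dom: "1 \<in> dom" and cost_one: "cost 1 = 0"
  using at_one by (auto simp: dom_def cost_def)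

lemma epi_iff: "(s, r) \<in> epi \<phi> \<longleftrightarrow> s \<in> dom \<and> cost s \<le> r"
proof (cases "s \<in> dom")
  case True
  then show ?thesis by (simp add: epi_def phi_eq_cost)
qed (auto simp: epi_def dom_def)

lemma closed_epi: "closed (epi \<phi>)" and convex_epi: "convex (epi \<phi>)"
  using proper_closed_convex by (auto simp: proper_closed_convex_def)

lemma dom_cost_convex:
  assumes "s \<in> dom" "s' \<in> dom" "0 \<le> u" "u \<le> 1"
  shows "(1 - u) * s + u * s' \<in> dom"
    and "cost ((1 - u) * s + u * s') \<le> (1 - u) * cost s + u * cost s'"
proof -
  have "(1 - u) *\<^sub>R (s, cost s) + u *\<^sub>R (s', cost s') \<in> epi \<phi>"
    using assms by (intro convexD[OF convex_epi]) (auto simp: epi_iff)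
  then show "(1 - u) * s + u * s' \<in> dom"
    "cost ((1 - u) * s + u * s') \<le> (1 - u) * cost s + u * cost s'"
    by (auto simp: epi_iff)
qed

lemma closed_sublevel: "closed {s. \<phi> s \<le> ereal r}"
proof -
  have "{s. \<phi> s \<le> ereal r} = (\<lambda>s. (s, r)) -` epi \<phi>" by (auto simp: epi_def)
  then show ?thesis
    using closed_epi by (auto intro!: closed_vimage continuous_intros)
qed

lemma measurable_phi[measurable]: "\<phi> \<in> borel_measurable borel"
  unfolding borel_measurable_iff_Iic_ereal
proof
  fix a
  have "\<phi> -` {..a} = {s. \<phi> s \<le> a}" by auto
  moreover have "{s. \<phi> s \<le> a} \<in> sets borel"
  proof (cases a)
    case (real r)
    then show ?thesis using closed_sublevel by (simp add: borel_closed)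
  next
    case MInf
    then have "{s. \<phi> s \<le> a} = {}" using nonneg by (auto simp: order.antisym)
    then show ?thesis by simp
  qed auto
  ultimately show "\<phi> -` {..a} \<inter> space borel \<in> sets borel" by simp
qed

lemma measurable_cost[measurable]: "cost \<in> borel_measurable borel"
  unfolding cost_def[abs_def] by measurable

lemma sets_dom[measurable]: "dom \<in> sets borel"
  unfolding dom_def by measurable

lemma conj_eq_SUP_dom: "v x = (SUP s\<in>dom. ereal (s * x - cost s))"
proof (rule antisym)
  show "v x \<le> (SUP s\<in>dom. ereal (s * x - cost s))"
    unfolding fenchel_conj_def
  proof (rule SUP_least)
    fix s
    show "ereal (s * x) - \<phi> s \<le> (SUP s\<in>dom. ereal (s * x - cost s))"
    proof (cases "s \<in> dom")
      case True
      then show ?thesis by (intro SUP_upper2[of s]) (auto simp: phi_eq_cost)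
    qed (auto simp: dom_def)
  qed
  show "(SUP s\<in>dom. ereal (s * x - cost s)) \<le> v x"
    unfolding fenchel_conj_def by (intro SUP_mono) (metis UNIV_I ereal_minus(1) phi_eq_cost order_refl)
qed

lemma young: "s \<in> dom \<Longrightarrow> ereal (s * x - cost s) \<le> v x"
  unfolding conj_eq_SUP_dom by (rule SUP_upper)

lemma conj_le_iff: "v x \<le> c \<longleftrightarrow> (\<forall>s\<in>dom. ereal (s * x - cost s) \<le> c)"
  unfolding conj_eq_SUP_dom by (rule SUP_le_iff)

lemma conj_mono: "x \<le> x' \<Longrightarrow> v x \<le> v x'"
  and conj_ge: "ereal x \<le> v x"
  and conj_zero: "v 0 = 0"
  and conj_eq_imp: "v x = ereal x \<Longrightarrow> x = 0"
  using disutility by (auto simp: risk_averse_disutility_def mono_def)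

lemma conj_nonneg: "0 \<le> x \<Longrightarrow> 0 \<le> v x"
  using conj_mono[of 0 x] conj_zero by simp

lemma measurable_conj[measurable]: "v \<in> borel_measurable borel"
  unfolding borel_measurable_iff_Iic_ereal
proof
  fix a
  have "v -` {..a} = {s. v s \<le> a}" by auto
  moreover have "{s. v s \<le> a} \<in> sets borel"
  proof (cases a)
    case (real r)
    then have "{x. v x \<le> a} = (\<Inter>s\<in>dom. {x. s * x - cost s \<le> r})"
      by (auto simp: conj_le_iff)
    also have "closed \<dots>"
      by (intro closed_INT ballI closed_Collect_le continuous_intros)
    finally show ?thesis by (rule borel_closed)
  next
    case MInf
    then have "{s. v s \<le> a} = {}" using conj_ge by (auto simp: leD less_eq_ereal_def) (metis MInfty_neq_ereal(1) conj_ge ereal_infty_less_eq(2))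
    then show ?thesis by simp
  qed auto
  ultimately show "v -` {..a} \<inter> space borel \<in> sets borel" by simp
qed

text \<open>If \<open>dom\<close> stayed below 1, then s - cost s \<le> 1 on it and v 1 = 1, against
  strictness of v x \<ge> x away from 0. The point -1 plays the same role for the other side of
  1.\<close>

lemma dom_above_one: "\<exists>s\<in>dom. 1 < s"
proof (rule ccontr)
  assume a: "\<not> ?thesis"
  have "v 1 \<le> ereal 1"
    unfolding conj_le_iff
  proof
    fix s assume "s \<in> dom"
    then show "ereal (s * 1 - cost s) \<le> ereal 1"
      using cost_nonneg[of s] a by auto
  qed
  then show False using conj_eq_imp[of 1] conj_ge[of 1] by (auto simp: order.antisym)
qed

lemma dom_below_one: "\<exists>s\<in>dom. s < 1"
proof (rule ccontr)
  assume a: "\<not> ?thesis"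
  have "v (-1) \<le> ereal (-1)"
    unfolding conj_le_iff
  proof
    fix s assume "s \<in> dom"
    then show "ereal (s * -1 - cost s) \<le> ereal (-1)"
      using cost_nonneg[of s] a by auto
  qed
  then show False using conj_eq_imp[of "-1"] conj_ge[of "-1"] by (auto simp: order.antisym)
qed

section \<open>Zeros of the generator and the perspective of its conjugate\<close>

text \<open>The zeros form a sublevel set of a closed convex function, bounded below by 0 and above
  by Young's inequality at a point where \<open>v\<close> is finite.\<close>

lemma zero_cost_interval:
  obtains a b where "{s \<in> dom. cost s = 0} = {a..b}"
proof -
  let ?Z = "{s \<in> dom. cost s = 0}"
  have eq: "?Z = {s. \<phi> s \<le> ereal 0}"
  proof (intro set_eqI iffI; clarify)
    fix s assume s: "\<phi> s \<le> ereal 0"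
    then have "s \<in> dom" by (auto simp: dom_def)
    then show "s \<in> dom \<and> cost s = 0"
      using s phi_eq_cost[of s] cost_nonneg[of s] by simp
  qed (simp add: phi_eq_cost)
  obtain t where t: "0 < t" "v t < \<infinity>" using conj_finite_at_pos by blast
  have "?Z \<subseteq> {0..real_of_ereal (v t) / t}"
  proof
    fix s assume s: "s \<in> ?Z"
    then have "s * t \<le> real_of_ereal (v t)"
      using young[of s t] t(2) by (cases "v t") auto
    then show "s \<in> {0..real_of_ereal (v t) / t}"
      using s t(1) dom_nonneg by (simp add: pos_le_divide_eq)
  qed
  then have "bounded ?Z" using bounded_subset bounded_closed_interval by blast
  moreover have "closed ?Z" unfolding eq by (rule closed_sublevel)
  moreover have "convex ?Z"
    unfolding convex_alt
  proof (intro ballI allI impI)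
    fix x y u :: real
    assume "x \<in> ?Z" "y \<in> ?Z" "0 \<le> u \<and> u \<le> 1"
    then show "(1 - u) *\<^sub>R x + u *\<^sub>R y \<in> ?Z"
      using dom_cost_convex[of x y u] cost_nonneg[of "(1 - u) * x + u * y"] by auto
  qed
  ultimately have "connected ?Z \<and> compact ?Z"
    by (simp add: convex_connected compact_eq_bounded_closed)
  then show ?thesis
    using that unfolding connected_compact_interval_1 by auto
qed

text \<open>The step \<open>d\<close> may be negative, so that one statement serves both ends of the
  zero set, pointing outward. Once \<open>s\<close> is more than one step beyond \<open>z\<close>,
  the point \<open>z + d\<close> lies between them, and convexity with zero cost at \<open>z\<close>
  makes the cost grow at least linearly. The summand 1 covers the points before that.\<close>

lemma cost_growth:
  assumes z: "z \<in> dom" "cost z = 0" and zd: "\<not> (z + d \<in> dom \<and> cost (z + d) = 0)"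
  obtains K where "0 \<le> K" "\<And>s. s \<in> dom \<Longrightarrow> (s - z) / d \<le> 1 + K * cost s"
proof
  \<comment> \<open>If \<open>z + d\<close> is outside \<open>dom\<close>, its \<open>cost\<close>
    is 0 and so is \<open>K\<close>. This is still correct: by convexity \<open>dom\<close> then has
    no points beyond \<open>z + d\<close>.\<close>
  define K where "K = 1 / cost (z + d)"
  show "0 \<le> K" by (simp add: K_def cost_nonneg)
  fix s assume s: "s \<in> dom"
  define \<tau> where "\<tau> = (s - z) / d"
  have d: "d \<noteq> 0" using z zd by auto
  show "(s - z) / d \<le> 1 + K * cost s"
  proof (cases "\<tau> \<le> 1")
    case True
    then show ?thesis
      using \<open>0 \<le> K\<close> cost_nonneg[of s] unfolding \<tau>_def[symmetric]
      by (simp add: add_increasing2)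
  next
    case False
    have "\<tau> * d = s - z" using d by (simp add: \<tau>_def)
    then have eq: "(1 - 1 / \<tau>) * z + 1 / \<tau> * s = z + d"
      using False by (simp add: field_simps)
    from dom_cost_convex[OF z(1) s, of "1 / \<tau>"] False
    have zd_dom: "z + d \<in> dom" and le: "cost (z + d) \<le> 1 / \<tau> * cost s"
      unfolding eq using z(2) by auto
    then have "0 < cost (z + d)" using zd cost_nonneg[of "z + d"] by simp
    with le False have "\<tau> \<le> K * cost s"
      by (simp add: K_def field_simps)
    then show ?thesis unfolding \<tau>_def[symmetric] by simp
  qed
qed

text \<open>As \<open>l\<close> grows, the perspective \<open>l v(y / l)\<close> decreases to the support function of the set of
  zeros of \<open>\<phi>\<close>; this closes the duality gap when the constraint \<open>\<epsilon> = 0\<close> has no Slater point.\<close>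

lemma perspective_bound:
  assumes Z: "{s \<in> dom. cost s = 0} = {a..b}" and "0 < \<delta>"
  shows "\<exists>L. \<forall>l\<ge>L. \<forall>s\<in>dom. s * y - l * cost s \<le> max (a * y) (b * y) + \<delta>"
proof -
  \<comment> \<open>Leaving the zero interval by \<eta> changes s * y by at most \<delta>; the added
    1 avoids dividing by zero.\<close>
  define \<eta> where "\<eta> = \<delta> / (\<bar>y\<bar> + 1)"
  have \<eta>: "0 < \<eta>" "\<bar>y\<bar> * \<eta> \<le> \<delta>" using \<open>0 < \<delta>\<close> by (auto simp: \<eta>_def field_simps)
  have "1 \<in> {a..b}"
    unfolding Z[symmetric] using one_in_dom cost_one by simp
  then have ab: "a \<in> {a..b}" "b \<in> {a..b}" by auto
  then have a: "a \<in> dom" "cost a = 0" and b: "b \<in> dom" "cost b = 0"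
    unfolding Z[symmetric] by auto
  have "b + \<eta> \<notin> {a..b}" "a + - \<eta> \<notin> {a..b}" using \<eta> by auto
  then have "\<not> (b + \<eta> \<in> dom \<and> cost (b + \<eta>) = 0)" "\<not> (a + - \<eta> \<in> dom \<and> cost (a + - \<eta>) = 0)"
    unfolding Z[symmetric] by auto
  then obtain K1 K2 where K: "0 \<le> K1" "0 \<le> K2"
    and K1: "\<And>s. s \<in> dom \<Longrightarrow> (s - b) / \<eta> \<le> 1 + K1 * cost s"
    and K2: "\<And>s. s \<in> dom \<Longrightarrow> (s - a) / - \<eta> \<le> 1 + K2 * cost s"
    using cost_growth[OF a] cost_growth[OF b] by metis
  define K where "K = \<eta> * (K1 + K2)"
  have K_ge: "\<eta> * K1 * c \<le> K * c" "\<eta> * K2 * c \<le> K * c" if "0 \<le> c" for c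
    using that K \<eta> by (auto simp: K_def intro!: mult_right_mono mult_left_mono)
  show ?thesis
  proof (intro exI allI impI ballI)
    \<comment> \<open>By \<open>cost_growth\<close>, \<open>s\<close> exceeds the interval enlarged
      by \<eta> by at most \<open>K * cost s\<close>. From this threshold on, the penalty
      \<open>l * cost s\<close> outweighs the resulting gain.\<close>
    fix l s assume l: "\<bar>y\<bar> * K \<le> l" and s: "s \<in> dom"
    let ?c = "cost s"
    have up: "s \<le> b + \<eta> + K * ?c"
      using K1[OF s] K_ge(1)[OF cost_nonneg[of s]] \<eta>(1)
      by (simp add: pos_divide_le_eq algebra_simps)
    have lo: "a - \<eta> - K * ?c \<le> s"
      using K2[OF s] K_ge(2)[OF cost_nonneg[of s]] \<eta>(1)
      by (simp add: neg_divide_le_eq algebra_simps del: divide_minus_right)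
    have "s * y \<le> max (a * y) (b * y) + \<bar>y\<bar> * \<eta> + \<bar>y\<bar> * K * ?c"
    proof (cases "0 \<le> y")
      case True
      then have "s * y \<le> (b + \<eta> + K * ?c) * y" using up by (intro mult_right_mono) auto
      then have "s * y \<le> b * y + \<bar>y\<bar> * \<eta> + \<bar>y\<bar> * K * ?c" using True by (simp add: algebra_simps)
      then show ?thesis using max.cobounded2[of "b * y" "a * y"] by linarith
    next
      case False
      then have "s * y \<le> (a - \<eta> - K * ?c) * y" using lo by (intro mult_right_mono_neg) auto
      then have "s * y \<le> a * y + \<bar>y\<bar> * \<eta> + \<bar>y\<bar> * K * ?c" using False by (simp add: algebra_simps)
      then show ?thesis using max.cobounded1[of "a * y" "b * y"] by linarith
    qed
    moreover have "\<bar>y\<bar> * K * ?c \<le> l * ?c" using l by (intro mult_right_mono cost_nonneg)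
    ultimately show "s * y - l * ?c \<le> max (a * y) (b * y) + \<delta>" using \<eta>(2) by linarith
  qed
qed

text \<open>The conjugate of l times \<phi>, made real. It has the right value only where v (y / l)
  is finite, so finiteness travels along as a separate fact.\<close>

definition perspective :: "real \<Rightarrow> real \<Rightarrow> real" where
  "perspective l y = l * real_of_ereal (v (y / l))"

lemma measurable_perspective[measurable]: "perspective l \<in> borel_measurable borel"
  unfolding perspective_def[abs_def] by measurable

lemma perspective_ge:
  assumes "0 < l" "v (y / l) < \<infinity>" "s \<in> dom"
  shows "s * y - l * cost s \<le> perspective l y"
proof -
  have "s * (y / l) - cost s \<le> real_of_ereal (v (y / l))"
    using young[OF assms(3), of "y / l"] assms(2) by (cases "v (y / l)") auto
  then have "l * (s * (y / l) - cost s) \<le> perspective l y"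
    unfolding perspective_def using assms(1) by (intro mult_left_mono) auto
  then show ?thesis using assms(1) by (simp add: algebra_simps)
qed

lemma perspective_le:
  assumes "0 < l" and B: "\<And>s. s \<in> dom \<Longrightarrow> s * y - l * cost s \<le> B"
  shows "v (y / l) < \<infinity>" "perspective l y \<le> B"
proof -
  have le: "v (y / l) \<le> ereal (B / l)"
    unfolding conj_le_iff
  proof
    fix s assume "s \<in> dom"
    then have "(s * y - l * cost s) / l \<le> B / l"
      using B assms(1) by (intro divide_right_mono) auto
    then show "ereal (s * (y / l) - cost s) \<le> ereal (B / l)"
      using assms(1) by (simp add: diff_divide_distrib)
  qed
  then show "v (y / l) < \<infinity>" by auto
  then have "real_of_ereal (v (y / l)) \<le> B / l"
    using le conj_ge[of "y / l"] by (cases "v (y / l)") auto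
  then show "perspective l y \<le> B"
    using assms(1) by (simp add: perspective_def field_simps)
qed

text \<open>Costs are nonnegative, so every term s * y - l * cost s of the supremum decreases in
  \<open>l\<close>; finiteness thus passes to all larger scales.\<close>

lemma perspective_antimono:
  assumes "0 < l" "l \<le> l'" "v (y / l) < \<infinity>"
  shows "v (y / l') < \<infinity>" "perspective l' y \<le> perspective l y"
proof -
  have "s * y - l' * cost s \<le> perspective l y" if "s \<in> dom" for s
    using perspective_ge[OF assms(1,3) that] mult_right_mono[OF assms(2) cost_nonneg[of s]] by linarith
  then show "v (y / l') < \<infinity>" "perspective l' y \<le> perspective l y"
    using perspective_le[of l' y "perspective l y"] assms(1,2) by auto
qed

lemma monotone_conj_le_cost:
  assumes "s \<in> dom"
  shows "monotone_conj v s \<le> ereal (cost s)"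
  unfolding monotone_conj_def
proof (rule SUP_least)
  fix t :: real assume "t \<in> {0..}"
  show "ereal (t * s) - v t \<le> ereal (cost s)"
    using young[OF assms, of t] by (cases "v t") (auto simp: mult.commute)
qed

text \<open>\<open>v\<close> is already a conjugate, of a function carried by the nonnegative
  half-line, and its monotone conjugate lies below \<open>cost\<close> on \<open>dom\<close>. With
  this, membership in \<open>M_space\<close> becomes a bound on the expectation of \<open>v\<close>
  at multiples of the modulus of X.\<close>

lemma monotone_biconjugate:
  assumes "0 \<le> x"
  shows "monotone_conj (monotone_conj v) x = v x"
proof (rule antisym)
  show "monotone_conj (monotone_conj v) x \<le> v x"
    unfolding monotone_conj_def[of "monotone_conj v"]
  proof (rule SUP_least)
    fix t :: real
    have *: "ereal (x * t) - v x \<le> monotone_conj v t"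
      unfolding monotone_conj_def using assms by (intro SUP_upper) auto
    then show "ereal (t * x) - monotone_conj v t \<le> v x"
      using conj_ge[of x] by (cases "v x"; cases "monotone_conj v t") (auto simp: mult.commute)
  qed
  show "v x \<le> monotone_conj (monotone_conj v) x"
    unfolding conj_le_iff
  proof
    fix s assume s: "s \<in> dom"
    have "ereal (s * x - cost s) \<le> ereal (s * x) - monotone_conj v s"
      using monotone_conj_le_cost[OF s] by (cases "monotone_conj v s") auto
    also have "\<dots> \<le> monotone_conj (monotone_conj v) x"
      unfolding monotone_conj_def[of "monotone_conj v"]
      using dom_nonneg[OF s] by (intro SUP_upper) auto
    finally show "ereal (s * x - cost s) \<le> monotone_conj (monotone_conj v) x" .
  qed
qed

lemma pointwise_optimal_imp_subdifferential:
  assumes "0 < l" and p: "p \<in> dom"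
    and opt: "\<And>s. s \<in> dom \<Longrightarrow> s * y - l * cost s \<le> p * y - l * cost p"
  shows "v (inverse l * y) = ereal (p * (inverse l * y) - cost p)"
    and "p \<in> subdifferential v (inverse l * y)"
proof -
  have "v (inverse l * y) \<le> ereal (p * (inverse l * y) - cost p)"
    unfolding conj_le_iff
  proof
    fix s assume "s \<in> dom"
    from opt[OF this] have "inverse l * (s * y - l * cost s) \<le> inverse l * (p * y - l * cost p)"
      using \<open>0 < l\<close> by (intro mult_left_mono) auto
    then show "ereal (s * (inverse l * y) - cost s) \<le> ereal (p * (inverse l * y) - cost p)"
      using \<open>0 < l\<close> by (simp add: field_simps)
  qed
  then show eq: "v (inverse l * y) = ereal (p * (inverse l * y) - cost p)"
    using young[OF p] by (simp add: order.antisym)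
  show "p \<in> subdifferential v (inverse l * y)"
    unfolding subdifferential_def eq using young[OF p] by (auto simp: algebra_simps)
qed

lemma conj_eq_imp_subdifferential:
  assumes p: "p \<in> dom" and eq: "v x = ereal (p * x - cost p)"
  shows "p \<in> subdifferential v x"
  unfolding subdifferential_def eq using young[OF p] by (auto simp: algebra_simps)

end

section \<open>Admissible functions\<close>

locale variational_problem = prob_space P + divergence_generator \<phi>
  for P :: "'a measure" and \<phi> :: "real \<Rightarrow> ereal" +
  fixes X :: "'a \<Rightarrow> real"
  assumes X_in_M_space: "X \<in> M_space P \<phi>"
begin

text \<open>Normalization is left out on purpose: it is the constraint to which \<mu> belongs, and
  without it the values may be changed freely on a measurable set. Up to null sets, the elements of
  mean 1 are the densities of finite divergence.\<close>

definition admissible :: "('a \<Rightarrow> real) set" where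
  "admissible = {p \<in> borel_measurable P. (AE \<theta> in P. p \<theta> \<in> dom) \<and> integrable P (\<lambda>\<theta>. cost (p \<theta>))}"

abbreviation mean_cost :: "('a \<Rightarrow> real) \<Rightarrow> real" where
  "mean_cost p \<equiv> (\<integral>\<theta>. cost (p \<theta>) \<partial>P)"

lemma admissibleD:
  assumes "p \<in> admissible"
  shows "p \<in> borel_measurable P" "AE \<theta> in P. p \<theta> \<in> dom" "integrable P (\<lambda>\<theta>. cost (p \<theta>))"
  using assms by (auto simp: admissible_def)

lemma X_measurable[measurable]: "X \<in> borel_measurable P"
  using X_in_M_space by (simp add: orlicz_space_def)

lemma X_bound:
  obtains a where "0 < a" "AE \<theta> in P. v \<bar>X \<theta> / a\<bar> < \<infinity>"
    "integrable P (\<lambda>\<theta>. real_of_ereal (v \<bar>X \<theta> / a\<bar>))"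
proof -
  obtain a where a: "0 < a"
    and "ereal_expectation P (\<lambda>\<theta>. monotone_conj (monotone_conj v) \<bar>X \<theta> / a\<bar>) < \<infinity>"
    using X_in_M_space by (auto simp: orlicz_space_def)
  then have "ereal_expectation P (\<lambda>\<theta>. v \<bar>X \<theta> / a\<bar>) < \<infinity>"
    using monotone_biconjugate by simp
  then have fin: "(\<integral>\<^sup>+\<theta>. e2ennreal (v \<bar>X \<theta> / a\<bar>) \<partial>P) < \<infinity>"
    by (subst (asm) ereal_expectation_less_PInf_iff) (auto intro: conj_nonneg)
  then have "AE \<theta> in P. e2ennreal (v \<bar>X \<theta> / a\<bar>) \<noteq> \<infinity>"
    by (intro nn_integral_PInf_AE) auto
  then have AE: "AE \<theta> in P. v \<bar>X \<theta> / a\<bar> < \<infinity>"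
    by eventually_elim auto
  have "AE \<theta> in P. e2ennreal (v \<bar>X \<theta> / a\<bar>) = ennreal (real_of_ereal (v \<bar>X \<theta> / a\<bar>))"
    using AE
  proof eventually_elim
    case (elim \<theta>)
    then show ?case using conj_ge[of "\<bar>X \<theta> / a\<bar>"] by (cases "v \<bar>X \<theta> / a\<bar>") auto
  qed
  from nn_integral_cong_AE[OF this] fin
  have "integrable P (\<lambda>\<theta>. real_of_ereal (v \<bar>X \<theta> / a\<bar>))"
    using conj_nonneg
    by (intro integrableI_nonneg) (auto intro!: AE_I2 real_of_ereal_pos)
  with a AE that show ?thesis by blast
qed

text \<open>Young's inequality supplies both dominating functions: at a constant t > 0 with finite
  \<open>v t\<close> for p, and at the scaled modulus of X for p * X.\<close>

lemma admissible_integrable: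
  assumes p: "p \<in> admissible"
  shows "integrable P p" "integrable P (\<lambda>\<theta>. p \<theta> * X \<theta>)"
proof -
  note [measurable] = admissibleD(1)[OF p]
  obtain t c where t: "0 < t" "v t = ereal c"
    using conj_finite_at_pos conj_ge by (metis ereal_cases ereal_infty_less(1) ereal_infty_less_eq(2) MInfty_neq_ereal(1))
  show "integrable P p"
  proof (rule Bochner_Integration.integrable_bound)
    show "integrable P (\<lambda>\<theta>. (cost (p \<theta>) + c) / t)"
      using admissibleD(3)[OF p] by simp
    show "AE \<theta> in P. norm (p \<theta>) \<le> norm ((cost (p \<theta>) + c) / t)"
      using admissibleD(2)[OF p]
    proof eventually_elim
      case (elim \<theta>)
      then have "0 \<le> p \<theta>" "p \<theta> * t \<le> cost (p \<theta>) + c"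
        using young[of "p \<theta>" t] t(2) dom_nonneg by auto
      then show ?case using t(1) by (simp add: field_simps)
    qed
  qed simp
  obtain a where a: "0 < a" "AE \<theta> in P. v \<bar>X \<theta> / a\<bar> < \<infinity>"
    "integrable P (\<lambda>\<theta>. real_of_ereal (v \<bar>X \<theta> / a\<bar>))" by (rule X_bound)
  show "integrable P (\<lambda>\<theta>. p \<theta> * X \<theta>)"
  proof (rule Bochner_Integration.integrable_bound)
    show "integrable P (\<lambda>\<theta>. (cost (p \<theta>) + real_of_ereal (v \<bar>X \<theta> / a\<bar>)) * a)"
      using admissibleD(3)[OF p] a by simp
    show "AE \<theta> in P. norm (p \<theta> * X \<theta>) \<le> norm ((cost (p \<theta>) + real_of_ereal (v \<bar>X \<theta> / a\<bar>)) * a)"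
      using admissibleD(2)[OF p] a(2)
    proof eventually_elim
      case (elim \<theta>)
      have "p \<theta> * \<bar>X \<theta> / a\<bar> \<le> cost (p \<theta>) + real_of_ereal (v \<bar>X \<theta> / a\<bar>)"
        using young[OF elim(1), of "\<bar>X \<theta> / a\<bar>"] elim(2)
        by (cases "v \<bar>X \<theta> / a\<bar>") auto
      then have "p \<theta> * \<bar>X \<theta> / a\<bar> * a \<le> (cost (p \<theta>) + real_of_ereal (v \<bar>X \<theta> / a\<bar>)) * a"
        using a(1) by (intro mult_right_mono) auto
      then have "p \<theta> * \<bar>X \<theta>\<bar> \<le> (cost (p \<theta>) + real_of_ereal (v \<bar>X \<theta> / a\<bar>)) * a"
        using a(1) by simp
      also have "\<dots> \<le> norm ((cost (p \<theta>) + real_of_ereal (v \<bar>X \<theta> / a\<bar>)) * a)" by simp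
      finally show ?case
        using dom_nonneg[OF elim(1)] by (simp add: abs_mult)
    qed
  qed simp
qed

lemma const_admissible: "s \<in> dom \<Longrightarrow> (\<lambda>_. s) \<in> admissible"
  by (simp add: admissible_def)

lemma X_integrable: "integrable P X"
  using admissible_integrable(2)[OF const_admissible[OF one_in_dom]] by simp

lemma admissible_convex:
  assumes p: "p \<in> admissible" and q: "q \<in> admissible" and u: "0 \<le> u" "u \<le> 1"
  shows "(\<lambda>\<theta>. (1 - u) * p \<theta> + u * q \<theta>) \<in> admissible"
    and "mean_cost (\<lambda>\<theta>. (1 - u) * p \<theta> + u * q \<theta>) \<le> (1 - u) * mean_cost p + u * mean_cost q"
proof -
  note [measurable] = admissibleD(1)[OF p] admissibleD(1)[OF q]
  note cost_int = admissibleD(3)[OF p] admissibleD(3)[OF q]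
  have dom: "AE \<theta> in P. (1 - u) * p \<theta> + u * q \<theta> \<in> dom"
    using admissibleD(2)[OF p] admissibleD(2)[OF q]
    by eventually_elim (use u in \<open>auto intro: dom_cost_convex\<close>)
  have le: "AE \<theta> in P. cost ((1 - u) * p \<theta> + u * q \<theta>) \<le> (1 - u) * cost (p \<theta>) + u * cost (q \<theta>)"
    using admissibleD(2)[OF p] admissibleD(2)[OF q]
    by eventually_elim (use u in \<open>auto intro: dom_cost_convex\<close>)
  have int: "integrable P (\<lambda>\<theta>. cost ((1 - u) * p \<theta> + u * q \<theta>))"
  proof (rule Bochner_Integration.integrable_bound)
    show "integrable P (\<lambda>\<theta>. (1 - u) * cost (p \<theta>) + u * cost (q \<theta>))"
      using cost_int by simp
    show "AE \<theta> in P. norm (cost ((1 - u) * p \<theta> + u * q \<theta>))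
        \<le> norm ((1 - u) * cost (p \<theta>) + u * cost (q \<theta>))"
      using le by eventually_elim (simp add: cost_nonneg)
  qed simp
  show "(\<lambda>\<theta>. (1 - u) * p \<theta> + u * q \<theta>) \<in> admissible"
    using dom int by (simp add: admissible_def)
  show "mean_cost (\<lambda>\<theta>. (1 - u) * p \<theta> + u * q \<theta>) \<le> (1 - u) * mean_cost p + u * mean_cost q"
    using integral_mono_AE[OF int _ le] cost_int by simp
qed

lemma integral_convex_combination:
  assumes "p \<in> admissible" "q \<in> admissible"
  shows "(\<integral>\<theta>. (1 - u) * p \<theta> + u * q \<theta> \<partial>P) = (1 - u) * (\<integral>\<theta>. p \<theta> \<partial>P) + u * (\<integral>\<theta>. q \<theta> \<partial>P)"
    and "pairing P (\<lambda>\<theta>. (1 - u) * p \<theta> + u * q \<theta>) X = (1 - u) * pairing P p X + u * pairing P q X"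
proof -
  note int = admissible_integrable[OF assms(1)] admissible_integrable[OF assms(2)]
  show "(\<integral>\<theta>. (1 - u) * p \<theta> + u * q \<theta> \<partial>P) = (1 - u) * (\<integral>\<theta>. p \<theta> \<partial>P) + u * (\<integral>\<theta>. q \<theta> \<partial>P)"
    using int by simp
  show "pairing P (\<lambda>\<theta>. (1 - u) * p \<theta> + u * q \<theta>) X = (1 - u) * pairing P p X + u * pairing P q X"
    using int by (simp add: pairing_def distrib_right mult.assoc)
qed

lemma divergence_admissible:
  assumes p: "p \<in> admissible"
  shows "divergence P \<phi> p = ereal (mean_cost p)"
proof -
  have "AE \<theta> in P. \<phi> (p \<theta>) = ereal (cost (p \<theta>))"
    using admissibleD(2)[OF p] by eventually_elim (rule phi_eq_cost)
  then show ?thesis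
    unfolding divergence_def
    using ereal_expectation_cong_AE ereal_expectation_ereal[OF admissibleD(3)[OF p]] by metis
qed

lemma admissible_if_divergence_finite:
  assumes [measurable]: "p \<in> borel_measurable P" and fin: "divergence P \<phi> p < \<infinity>"
  shows "p \<in> admissible"
proof -
  have fin': "(\<integral>\<^sup>+\<theta>. e2ennreal (\<phi> (p \<theta>)) \<partial>P) < \<infinity>"
    using fin nonneg unfolding divergence_def by (subst (asm) ereal_expectation_less_PInf_iff)
  then have "AE \<theta> in P. e2ennreal (\<phi> (p \<theta>)) \<noteq> \<infinity>"
    by (intro nn_integral_PInf_AE) auto
  then have dom: "AE \<theta> in P. p \<theta> \<in> dom"
    by eventually_elim (auto simp: dom_def)
  then have "AE \<theta> in P. e2ennreal (\<phi> (p \<theta>)) = ennreal (cost (p \<theta>))"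
    by eventually_elim (simp add: phi_eq_cost)
  from nn_integral_cong_AE[OF this] fin'
  have "integrable P (\<lambda>\<theta>. cost (p \<theta>))"
    by (intro integrableI_nonneg) (auto simp: cost_nonneg)
  with dom show ?thesis by (simp add: admissible_def)
qed

text \<open>The monotone conjugate is below \<open>cost\<close>, so the Orlicz scale 1 works.
  Together with \<open>admissible_if_divergence_finite\<close> this shows that
  \<open>admissible\<close> is exactly the part of \<open>L_space\<close> with finite divergence,
  over which the conjugate of the scaled divergence is effectively taken.\<close>

lemma admissible_in_L_space:
  assumes p: "p \<in> admissible"
  shows "p \<in> L_space P \<phi>"
proof -
  have "AE \<theta> in P. monotone_conj v \<bar>p \<theta> / 1\<bar> \<le> ereal (cost (p \<theta>))"
    using admissibleD(2)[OF p] by eventually_elim (use monotone_conj_le_cost dom_nonneg in force)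
  from ereal_expectation_mono_AE[OF this]
  have "ereal_expectation P (\<lambda>\<theta>. monotone_conj v \<bar>p \<theta> / 1\<bar>) \<le> ereal (mean_cost p)"
    by (simp only: ereal_expectation_ereal[OF admissibleD(3)[OF p]])
  then have "ereal_expectation P (\<lambda>\<theta>. monotone_conj v \<bar>p \<theta> / 1\<bar>) < \<infinity>"
    by (rule order_le_less_trans) simp
  then show ?thesis
    unfolding orlicz_space_def using admissibleD(1)[OF p] by (auto intro!: exI[of _ 1])
qed

section \<open>Interchange of maximization and integration\<close>

lemma admissible_patch:
  assumes p: "p \<in> admissible" and s: "s \<in> dom" and A[measurable]: "Measurable.pred P A"
  shows "(\<lambda>\<theta>. if A \<theta> then s else p \<theta>) \<in> admissible"
proof -
  note [measurable] = admissibleD(1)[OF p]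
  have "integrable P (\<lambda>\<theta>. cost (if A \<theta> then s else p \<theta>))"
  proof (rule Bochner_Integration.integrable_bound)
    show "integrable P (\<lambda>\<theta>. cost s + cost (p \<theta>))"
      using admissibleD(3)[OF p] by simp
  qed (auto simp: cost_nonneg)
  moreover have "AE \<theta> in P. (if A \<theta> then s else p \<theta>) \<in> dom"
    using admissibleD(2)[OF p] by eventually_elim (use s in simp)
  ultimately show ?thesis by (simp add: admissible_def)
qed

text \<open>Maximization commutes with integration: where some \<open>s\<close> beats \<open>p\<close>, patching \<open>p\<close> by the
  constant \<open>s\<close> would improve the integral. A countable dense subset of the epigraph suffices to
  test optimality at every point of the domain, also where \<open>\<phi>\<close> is discontinuous.\<close>

lemma optimal_imp_pointwise_optimal:
  assumes p: "p \<in> admissible" and l: "0 \<le> l"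
    and opt: "\<And>q. q \<in> admissible \<Longrightarrow>
      pairing P q X - l * mean_cost q - \<mu> * (\<integral>\<theta>. q \<theta> \<partial>P)
        \<le> pairing P p X - l * mean_cost p - \<mu> * (\<integral>\<theta>. p \<theta> \<partial>P)"
  shows "AE \<theta> in P. \<forall>s\<in>dom. s * (X \<theta> - \<mu>) - l * cost s \<le> p \<theta> * (X \<theta> - \<mu>) - l * cost (p \<theta>)"
proof -
  note [measurable] = admissibleD(1)[OF p]
  define G where "G = (\<lambda>q \<theta>. q * (X \<theta> - \<mu>) - l * cost q)"
  have G_int: "integrable P (\<lambda>\<theta>. G (q \<theta>) \<theta>)"
    and G_eq: "(\<integral>\<theta>. G (q \<theta>) \<theta> \<partial>P) = pairing P q X - l * mean_cost q - \<mu> * (\<integral>\<theta>. q \<theta> \<partial>P)"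
    if "q \<in> admissible" for q
    using admissible_integrable[OF that] admissibleD(3)[OF that]
    by (simp_all add: G_def pairing_def right_diff_distrib mult.commute[of _ \<mu>])
  have single: "AE \<theta> in P. G s \<theta> \<le> G (p \<theta>) \<theta>" if s: "s \<in> dom" for s
  proof -
    define A where "A \<theta> \<longleftrightarrow> G (p \<theta>) \<theta> < G s \<theta>" for \<theta>
    have A[measurable]: "Measurable.pred P A"
      unfolding A_def[abs_def] G_def by measurable
    define q where "q = (\<lambda>\<theta>. if A \<theta> then s else p \<theta>)"
    have q: "q \<in> admissible"
      unfolding q_def by (rule admissible_patch[OF p s A])
    have "(\<integral>\<theta>. G (q \<theta>) \<theta> - G (p \<theta>) \<theta> \<partial>P) \<le> 0"
      using opt[OF q] G_int[OF q] G_int[OF p] by (simp add: G_eq p q)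
    moreover have ge: "AE \<theta> in P. 0 \<le> G (q \<theta>) \<theta> - G (p \<theta>) \<theta>"
      by (auto simp: q_def A_def)
    ultimately have "(\<integral>\<theta>. G (q \<theta>) \<theta> - G (p \<theta>) \<theta> \<partial>P) = 0"
      by (simp add: integral_nonneg_AE antisym)
    then have "AE \<theta> in P. G (q \<theta>) \<theta> - G (p \<theta>) \<theta> = 0"
      using integral_nonneg_eq_0_iff_AE[OF _ ge] G_int[OF q] G_int[OF p] by auto
    then show ?thesis
      by eventually_elim (auto simp: q_def A_def split: if_splits)
  qed
  \<comment> \<open>The null set in \<open>single\<close> depends on \<open>s\<close>, so only
    countably many tests can be merged into one.\<close>
  obtain D where D: "countable D" "D \<subseteq> epi \<phi>" "epi \<phi> \<subseteq> closure D"
    by (rule separable)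
  have "AE \<theta> in P. \<forall>d\<in>D. G (fst d) \<theta> \<le> G (p \<theta>) \<theta>"
    unfolding AE_ball_countable[OF D(1)]
    using D(2) single epi_iff by (metis prod.collapse subsetD)
  then show ?thesis
  proof eventually_elim
    case (elim \<theta>)
    \<comment> \<open>Replacing the cost by the height of the epigraph point makes the condition
      affine, so it passes to limits of \<open>D\<close>. As l \<ge> 0, a greater height only
      weakens it.\<close>
    let ?H = "{d. fst d * (X \<theta> - \<mu>) - l * snd d \<le> G (p \<theta>) \<theta>}"
    have "D \<subseteq> ?H"
    proof
      fix d assume d: "d \<in> D"
      then have "cost (fst d) \<le> snd d"
        using D(2) epi_iff[of "fst d" "snd d"] by auto
      then have "l * cost (fst d) \<le> l * snd d"
        using l by (rule mult_left_mono)
      then show "d \<in> ?H" using elim d by (auto simp: G_def)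
    qed
    moreover have "closed ?H"
      by (intro closed_Collect_le continuous_intros)
    ultimately have "epi \<phi> \<subseteq> ?H"
      using D(3) closure_minimal by blast
    moreover have "(s, cost s) \<in> epi \<phi>" if "s \<in> dom" for s
      using that by (simp add: epi_iff)
    ultimately show ?case by (force simp: G_def)
  qed
qed

section \<open>The multiplier of the mean constraint\<close>

text \<open>The constants on both sides of 1 are the Slater points. The class \<open>K\<close> is
  kept general because the case \<epsilon> = 0 uses the functions of zero cost instead of all
  admissible ones.\<close>

lemma mean_multiplier:
  assumes K: "K \<subseteq> admissible"
    and K_convex: "\<And>p q u. p \<in> K \<Longrightarrow> q \<in> K \<Longrightarrow> 0 \<le> u \<Longrightarrow> u \<le> 1 \<Longrightarrow> (\<lambda>\<theta>. (1 - u) * p \<theta> + u * q \<theta>) \<in> K"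
    and below: "(\<lambda>_. s1) \<in> K" "s1 < 1" and above: "(\<lambda>_. s2) \<in> K" "1 < s2"
    and l: "0 \<le> l"
    and opt: "\<And>q. q \<in> K \<Longrightarrow> (\<integral>\<theta>. q \<theta> \<partial>P) = 1 \<Longrightarrow> pairing P q X - l * mean_cost q \<le> V"
  obtains \<mu> where "\<And>q. q \<in> K \<Longrightarrow> pairing P q X - l * mean_cost q - \<mu> * (\<integral>\<theta>. q \<theta> \<partial>P) \<le> V - \<mu>"
proof -
  \<comment> \<open>The mean is affine but the penalized value only concave, so convexity requires
    all smaller values to be included as well.\<close>
  define C where "C = {((\<integral>\<theta>. q \<theta> \<partial>P), r) | q r. q \<in> K \<and> r \<le> pairing P q X - l * mean_cost q}"
  have CI: "((\<integral>\<theta>. q \<theta> \<partial>P), pairing P q X - l * mean_cost q) \<in> C" if "q \<in> K" for q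
    using that by (auto simp: C_def)
  have "convex C"
    unfolding convex_alt
  proof (intro ballI allI impI)
    fix c d and u :: real
    assume "c \<in> C" "d \<in> C" and u: "0 \<le> u \<and> u \<le> 1"
    then obtain p r q r' where c: "c = ((\<integral>\<theta>. p \<theta> \<partial>P), r)" "p \<in> K" "r \<le> pairing P p X - l * mean_cost p"
      and d: "d = ((\<integral>\<theta>. q \<theta> \<partial>P), r')" "q \<in> K" "r' \<le> pairing P q X - l * mean_cost q"
      by (auto simp: C_def)
    let ?m = "\<lambda>\<theta>. (1 - u) * p \<theta> + u * q \<theta>"
    have pq: "p \<in> admissible" "q \<in> admissible" using K c d by auto
    have "l * mean_cost ?m \<le> l * ((1 - u) * mean_cost p + u * mean_cost q)"
      using admissible_convex(2)[OF pq] u l by (intro mult_left_mono) auto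
    moreover have "(1 - u) * r + u * r'
        \<le> (1 - u) * (pairing P p X - l * mean_cost p) + u * (pairing P q X - l * mean_cost q)"
      using c d u by (intro add_mono mult_left_mono) auto
    ultimately have "(1 - u) * r + u * r' \<le> pairing P ?m X - l * mean_cost ?m"
      unfolding integral_convex_combination[OF pq] by (simp add: algebra_simps)
    then show "(1 - u) *\<^sub>R c + u *\<^sub>R d \<in> C"
      unfolding C_def c(1) d(1) using integral_convex_combination(1)[OF pq] K_convex[OF c(2) d(2)] u
      by (auto intro!: exI[of _ ?m])
  qed
  moreover have "r \<le> V" if "(1, r) \<in> C" for r
  proof -
    from that obtain q where "q \<in> K" "1 = (\<integral>\<theta>. q \<theta> \<partial>P)" "r \<le> pairing P q X - l * mean_cost q"
      by (auto simp: C_def)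
    then show ?thesis using opt[of q] by simp
  qed
  moreover have "(s1, pairing P (\<lambda>_. s1) X - l * cost s1) \<in> C"
    "(s2, pairing P (\<lambda>_. s2) X - l * cost s2) \<in> C"
    using CI[OF below(1)] CI[OF above(1)] by (simp_all add: prob_space)
  ultimately obtain \<mu> where "\<And>s r. (s, r) \<in> C \<Longrightarrow> r \<le> V + \<mu> * (s - 1)"
    using supporting_slope[of C 1 V] below(2) above(2) by metis
  then show ?thesis
    using CI that[of \<mu>] by (fastforce simp: algebra_simps)
qed


corollary admissible_mean_multiplier:
  assumes "0 \<le> l"
    and "\<And>q. q \<in> admissible \<Longrightarrow> (\<integral>\<theta>. q \<theta> \<partial>P) = 1 \<Longrightarrow> pairing P q X - l * mean_cost q \<le> V"
  obtains \<mu> where "\<And>q. q \<in> admissible \<Longrightarrow>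
    pairing P q X - l * mean_cost q - \<mu> * (\<integral>\<theta>. q \<theta> \<partial>P) \<le> V - \<mu>"
proof -
  obtain s1 s2 where s: "s1 \<in> dom" "s1 < 1" "s2 \<in> dom" "1 < s2"
    using dom_above_one dom_below_one by blast
  show thesis
    by (rule mean_multiplier[OF subset_refl _ const_admissible[OF s(1)] s(2)
          const_admissible[OF s(3)] s(4) assms])
      (auto intro: admissible_convex(1) that)
qed

lemma pairing_shift:
  assumes "p \<in> admissible"
  shows "pairing P p (\<lambda>\<theta>. X \<theta> - \<mu>) = pairing P p X - \<mu> * (\<integral>\<theta>. p \<theta> \<partial>P)"
  using admissible_integrable[OF assms] by (simp add: pairing_def right_diff_distrib mult.commute[of _ \<mu>])

section \<open>Absence of a duality gap for a zero divergence budget\<close>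

text \<open>The perspectives at \<open>X - \<mu>\<close> bound the Lagrangian by Young's inequality
  and decrease to the support function of the zero interval. Dominated convergence then yields one
  scale that is good enough in the mean.\<close>

lemma perspective_integral_bound:
  assumes Z: "{s \<in> dom. cost s = 0} = {a..b}" and \<delta>: "0 < \<delta>"
  obtains l where "0 < l" "\<And>q. q \<in> admissible \<Longrightarrow>
    pairing P q X - l * mean_cost q - \<mu> * (\<integral>\<theta>. q \<theta> \<partial>P)
      \<le> (\<integral>\<theta>. max (a * (X \<theta> - \<mu>)) (b * (X \<theta> - \<mu>)) \<partial>P) + \<delta>"
proof -
  have "1 \<in> {a..b}"
    unfolding Z[symmetric] using one_in_dom cost_one by simp
  then have "a \<in> {a..b}" "b \<in> {a..b}" by auto
  then have ab: "a \<in> dom" "cost a = 0" "b \<in> dom" "cost b = 0"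
    unfolding Z[symmetric] by auto
  define h where "h = (\<lambda>\<theta>. max (a * (X \<theta> - \<mu>)) (b * (X \<theta> - \<mu>)))"
  have h_int: "integrable P h"
    unfolding h_def using X_integrable by simp
  obtain c where c: "0 < c" "AE \<theta> in P. v \<bar>X \<theta> / c\<bar> < \<infinity>"
    "integrable P (\<lambda>\<theta>. real_of_ereal (v \<bar>X \<theta> / c\<bar>))" by (rule X_bound)
  obtain t where t: "0 < t" "v t < \<infinity>" using conj_finite_at_pos by blast
  \<comment> \<open>Each lower bound controls half of the quotient: X / l0 is at most half of the
    modulus of X / c, and the modulus of \<mu> / l0 at most t / 2. Hence (X - \<mu>) / l0 is at most
    the larger of two arguments at which \<open>v\<close> is finite almost everywhere, and the first
    perspective is integrable.\<close>
  define l0 where "l0 = max (2 * c) (2 * \<bar>\<mu>\<bar> / t)"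
  have l0: "0 < l0" "2 * c \<le> l0" "2 * \<bar>\<mu>\<bar> \<le> l0 * t"
    using c(1) t(1) by (auto simp: l0_def pos_divide_le_eq[symmetric])
  have half: "(X \<theta> - \<mu>) / l0 \<le> max \<bar>X \<theta> / c\<bar> t" for \<theta>
  proof -
    have "X \<theta> - \<mu> \<le> (\<bar>X \<theta>\<bar> / c) * c + \<bar>\<mu>\<bar>" using c(1) by simp
    also have "\<dots> \<le> max \<bar>X \<theta> / c\<bar> t * (l0 / 2) + max \<bar>X \<theta> / c\<bar> t * (l0 / 2)"
    proof (rule add_mono)
      show "(\<bar>X \<theta>\<bar> / c) * c \<le> max \<bar>X \<theta> / c\<bar> t * (l0 / 2)"
        using c(1) t(1) l0 by (intro mult_mono) auto
      have "t * (l0 / 2) \<le> max \<bar>X \<theta> / c\<bar> t * (l0 / 2)"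
        using l0 by (intro mult_right_mono) auto
      then show "\<bar>\<mu>\<bar> \<le> max \<bar>X \<theta> / c\<bar> t * (l0 / 2)"
        using l0(3) by (simp add: mult.commute)
    qed
    finally show ?thesis using l0(1) by (simp add: pos_divide_le_eq mult.commute)
  qed
  have v_le: "v ((X \<theta> - \<mu>) / l0) \<le> v \<bar>X \<theta> / c\<bar> + v t" for \<theta>
  proof -
    have "v ((X \<theta> - \<mu>) / l0) \<le> v (max \<bar>X \<theta> / c\<bar> t)" by (rule conj_mono[OF half])
    also have "\<dots> \<le> v \<bar>X \<theta> / c\<bar> + v t"
      using add_right_mono[OF conj_nonneg[of "\<bar>X \<theta> / c\<bar>"], of "v t"]
        add_left_mono[OF conj_nonneg[of t], of "v \<bar>X \<theta> / c\<bar>"] t(1)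
      by (simp add: max_def)
    finally show ?thesis .
  qed
  have fin0: "AE \<theta> in P. v ((X \<theta> - \<mu>) / l0) < \<infinity>"
    using c(2)
  proof eventually_elim
    case (elim \<theta>)
    then show ?case by (intro order_le_less_trans[OF v_le]) (use t(2) in auto)
  qed
  define k where "k n \<theta> = perspective (l0 + real n) (X \<theta> - \<mu>)" for n \<theta>
  have k_measurable[measurable]: "k n \<in> borel_measurable P" for n
    unfolding k_def[abs_def] by measurable
  have fin: "AE \<theta> in P. v ((X \<theta> - \<mu>) / (l0 + real n)) < \<infinity>" for n
    using fin0 by eventually_elim (use perspective_antimono(1)[OF l0(1)] in auto)
  have k_ge: "AE \<theta> in P. h \<theta> \<le> k n \<theta>" for n
    using fin[of n]
  proof eventually_elim
    case (elim \<theta>)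
    have "0 < l0 + real n" using l0(1) by simp
    from perspective_ge[OF this elim ab(1)] perspective_ge[OF this elim ab(3)]
    show ?case by (simp add: h_def k_def ab)
  qed
  have k_le: "AE \<theta> in P. k n \<theta> \<le> k 0 \<theta>" for n
    using fin0 by eventually_elim (use perspective_antimono(2)[OF l0(1)] in \<open>auto simp: k_def\<close>)
  have k0: "integrable P (k 0)"
  proof (rule Bochner_Integration.integrable_bound)
    show "integrable P (\<lambda>\<theta>. \<bar>h \<theta>\<bar> + l0 * (real_of_ereal (v \<bar>X \<theta> / c\<bar>) + real_of_ereal (v t)))"
      using h_int c(3) by auto
    show "AE \<theta> in P. norm (k 0 \<theta>)
        \<le> norm (\<bar>h \<theta>\<bar> + l0 * (real_of_ereal (v \<bar>X \<theta> / c\<bar>) + real_of_ereal (v t)))"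
      using k_ge[of 0] c(2) fin0
    proof eventually_elim
      case (elim \<theta>)
      let ?B = "real_of_ereal (v \<bar>X \<theta> / c\<bar>) + real_of_ereal (v t)"
      have "real_of_ereal (v ((X \<theta> - \<mu>) / l0)) \<le> ?B"
        using v_le[of \<theta>] elim t(2) conj_ge[of t] conj_ge[of "\<bar>X \<theta> / c\<bar>"] conj_ge[of "(X \<theta> - \<mu>) / l0"]
        by (cases "v ((X \<theta> - \<mu>) / l0)"; cases "v \<bar>X \<theta> / c\<bar>"; cases "v t") auto
      then have le: "k 0 \<theta> \<le> l0 * ?B"
        using l0(1) by (simp add: k_def perspective_def)
      have "0 \<le> ?B"
        using conj_nonneg t(1) by (intro add_nonneg_nonneg real_of_ereal_pos) auto
      then have "0 \<le> l0 * ?B" using l0(1) by simp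
      with le elim(1) show ?case by simp
    qed
  qed simp
  have "(\<lambda>n. \<integral>\<theta>. k n \<theta> \<partial>P) \<longlonglongrightarrow> (\<integral>\<theta>. h \<theta> \<partial>P)"
  proof (rule integral_dominated_convergence)
    show "integrable P (\<lambda>\<theta>. \<bar>h \<theta>\<bar> + \<bar>k 0 \<theta>\<bar>)" using h_int k0 by auto
    show "AE \<theta> in P. norm (k n \<theta>) \<le> \<bar>h \<theta>\<bar> + \<bar>k 0 \<theta>\<bar>" for n
      using k_ge[of n] k_le[of n] by eventually_elim auto
    have "AE \<theta> in P. \<forall>n. h \<theta> \<le> k n \<theta>"
      using k_ge by (simp add: AE_all_countable)
    then show "AE \<theta> in P. (\<lambda>n. k n \<theta>) \<longlonglongrightarrow> h \<theta>"
    proof eventually_elim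
      case (elim \<theta>)
      show ?case
      proof (rule LIMSEQ_I)
        fix r :: real assume "0 < r"
        obtain L where L: "\<And>l s. L \<le> l \<Longrightarrow> s \<in> dom \<Longrightarrow>
            s * (X \<theta> - \<mu>) - l * cost s \<le> h \<theta> + r / 2"
          unfolding h_def using perspective_bound[OF Z, of "r / 2" "X \<theta> - \<mu>"] \<open>0 < r\<close> by auto
        obtain N where N: "L \<le> real N" using real_arch_simple by blast
        have "norm (k n \<theta> - h \<theta>) < r" if "N \<le> n" for n
        proof -
          have "L \<le> l0 + real n" using N that l0(1) by linarith
          then have "k n \<theta> \<le> h \<theta> + r / 2"
            unfolding k_def using L l0(1) by (intro perspective_le(2)) auto
          with elim[rule_format, of n] \<open>0 < r\<close> show ?thesis by auto
        qed
        then show "\<exists>N. \<forall>n\<ge>N. norm (k n \<theta> - h \<theta>) < r" by blast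
      qed
    qed
  qed (use h_int in auto)
  from LIMSEQ_D[OF this \<delta>] obtain n where n: "\<bar>(\<integral>\<theta>. k n \<theta> \<partial>P) - (\<integral>\<theta>. h \<theta> \<partial>P)\<bar> < \<delta>"
    by auto
  have k_int: "integrable P (k n)"
  proof (rule Bochner_Integration.integrable_bound)
    show "integrable P (\<lambda>\<theta>. \<bar>h \<theta>\<bar> + \<bar>k 0 \<theta>\<bar>)" using h_int k0 by auto
    show "AE \<theta> in P. norm (k n \<theta>) \<le> norm (\<bar>h \<theta>\<bar> + \<bar>k 0 \<theta>\<bar>)"
      using k_ge[of n] k_le[of n] by eventually_elim auto
  qed simp
  show ?thesis
  proof
    show "0 < l0 + real n" using l0(1) by simp
    fix q assume q: "q \<in> admissible"
    note int = admissible_integrable[OF q] admissibleD(3)[OF q]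
    have "(\<integral>\<theta>. q \<theta> * X \<theta> - \<mu> * q \<theta> - (l0 + real n) * cost (q \<theta>) \<partial>P) \<le> (\<integral>\<theta>. k n \<theta> \<partial>P)"
    proof (rule integral_mono_AE)
      show "AE \<theta> in P. q \<theta> * X \<theta> - \<mu> * q \<theta> - (l0 + real n) * cost (q \<theta>) \<le> k n \<theta>"
        using fin[of n] admissibleD(2)[OF q]
      proof eventually_elim
        case (elim \<theta>)
        then show ?case
          using perspective_ge[of "l0 + real n" "X \<theta> - \<mu>" "q \<theta>"] l0(1)
          by (simp add: k_def right_diff_distrib mult.commute[of \<mu>])
      qed
    qed (use int k_int in auto)
    then show "pairing P q X - (l0 + real n) * mean_cost q - \<mu> * (\<integral>\<theta>. q \<theta> \<partial>P)
      \<le> (\<integral>\<theta>. max (a * (X \<theta> - \<mu>)) (b * (X \<theta> - \<mu>)) \<partial>P) + \<delta>"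
      using int n by (simp add: pairing_def h_def)
  qed
qed

lemma truncated_mean_tendsto_0:
  assumes "integrable P Y"
  shows "(\<lambda>n. \<integral>\<theta>. max 0 (Y \<theta> - real n) \<partial>P) \<longlonglongrightarrow> 0"
proof -
  have "(\<lambda>n. \<integral>\<theta>. max 0 (Y \<theta> - real n) \<partial>P) \<longlonglongrightarrow> (\<integral>\<theta>. 0 \<partial>P)"
  proof (rule integral_dominated_convergence)
    show "AE \<theta> in P. (\<lambda>n. max 0 (Y \<theta> - real n)) \<longlonglongrightarrow> 0"
    proof (rule AE_I2)
      fix \<theta>
      obtain N where "Y \<theta> \<le> real N" using real_arch_simple by blast
      then have "eventually (\<lambda>n. max 0 (Y \<theta> - real n) = 0) sequentially"
        by (intro eventually_sequentiallyI[of N]) auto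
      then show "(\<lambda>n. max 0 (Y \<theta> - real n)) \<longlonglongrightarrow> 0" by (rule tendsto_eventually)
    qed
    show "integrable P (\<lambda>\<theta>. \<bar>Y \<theta>\<bar>)" using assms by simp
  qed (use assms in auto)
  then show ?thesis by simp
qed

text \<open>The maximum in the integrand is the support function of the zero interval. The slack
  \<delta> is for the case that 1 is an endpoint, where the mean constraint has no Slater point and
  the infimum over \<mu> may only be approached.\<close>

lemma zero_cost_dual:
  assumes Z: "{s \<in> dom. cost s = 0} = {a..b}" and \<delta>: "0 < \<delta>"
    and opt: "\<And>q. q \<in> admissible \<Longrightarrow> (\<integral>\<theta>. q \<theta> \<partial>P) = 1 \<Longrightarrow> mean_cost q = 0 \<Longrightarrow> pairing P q X \<le> V"
  obtains \<mu> where "(\<integral>\<theta>. max (a * (X \<theta> - \<mu>)) (b * (X \<theta> - \<mu>)) \<partial>P) \<le> V - \<mu> + \<delta>"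
proof -
  have one: "1 \<in> {a..b}"
    unfolding Z[symmetric] using one_in_dom cost_one by simp
  then have "a \<in> {a..b}" "b \<in> {a..b}" by auto
  then have ab: "a \<in> dom" "cost a = 0" "b \<in> dom" "cost b = 0"
    unfolding Z[symmetric] by auto
  have mean_X: "(\<integral>\<theta>. X \<theta> \<partial>P) \<le> V"
    using opt[OF const_admissible[OF one_in_dom]] by (simp add: prob_space cost_one pairing_def)
  consider "a < 1" "1 < b" | "b = 1" | "a = 1" using one by force
  then show ?thesis
  proof cases
    case 1
    define K where "K = {q \<in> admissible. mean_cost q = 0}"
    have mean_cost_nonneg: "0 \<le> mean_cost q" for q
      by (simp add: cost_nonneg)
    have K_convex: "(\<lambda>\<theta>. (1 - u) * p \<theta> + u * q \<theta>) \<in> K"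
      if "p \<in> K" "q \<in> K" "0 \<le> u" "u \<le> 1" for p q u
      using that admissible_convex[of p q u] mean_cost_nonneg[of "\<lambda>\<theta>. (1 - u) * p \<theta> + u * q \<theta>"]
      by (auto simp: K_def intro: order.antisym)
    have const_K: "(\<lambda>_. a) \<in> K" "(\<lambda>_. b) \<in> K"
      using ab const_admissible by (auto simp: K_def)
    obtain \<mu> where \<mu>: "\<And>q. q \<in> K \<Longrightarrow> pairing P q X - 0 * mean_cost q - \<mu> * (\<integral>\<theta>. q \<theta> \<partial>P) \<le> V - \<mu>"
      using mean_multiplier[of K a b 0 V] K_convex const_K 1 opt by (auto simp: K_def)
    \<comment> \<open>The bang-bang function that attains the support function at
      \<open>X - \<mu>\<close> pointwise while its cost stays zero.\<close>
    define q where "q = (\<lambda>\<theta>. if \<mu> \<le> X \<theta> then b else a)"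
    have q: "q \<in> admissible"
      unfolding q_def by (rule admissible_patch[OF const_admissible]) (use ab in auto)
    have "mean_cost q = 0" using ab by (simp add: q_def if_distrib[of cost] cong: if_cong)
    with q have "q \<in> K" by (simp add: K_def)
    have "q \<theta> * (X \<theta> - \<mu>) = max (a * (X \<theta> - \<mu>)) (b * (X \<theta> - \<mu>))" for \<theta>
      using 1 by (auto simp: q_def max_def mult_right_mono mult_right_mono_neg
          intro: order.antisym mult_right_mono mult_right_mono_neg)
    then have "(\<integral>\<theta>. max (a * (X \<theta> - \<mu>)) (b * (X \<theta> - \<mu>)) \<partial>P) = pairing P q (\<lambda>\<theta>. X \<theta> - \<mu>)"
      by (simp add: pairing_def)
    also have "\<dots> \<le> V - \<mu>"
      using \<mu>[OF \<open>q \<in> K\<close>] by (simp add: pairing_shift[OF q])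
    finally show ?thesis using that[of \<mu>] \<delta> by linarith
  next
    \<comment> \<open>Values at most 1 with mean 1 leave only the constant 1, whose value is the
      mean of X. The dual approaches it as \<mu> = -n tends to minus infinity.\<close>
    case 2
    have eq: "max (a * y) (b * y) = y + (1 - a) * max 0 (- y)" for y
      using one 2 mult_right_mono[of a 1 y] mult_right_mono_neg[of a 1 y]
      by (cases "0 \<le> y") (auto simp: max_def algebra_simps)
    have "(\<lambda>n. (1 - a) * (\<integral>\<theta>. max 0 (- X \<theta> - real n) \<partial>P)) \<longlonglongrightarrow> (1 - a) * 0"
      using X_integrable by (intro tendsto_mult_left truncated_mean_tendsto_0) simp
    from LIMSEQ_D[OF this \<delta>] obtain n
      where "norm ((1 - a) * (\<integral>\<theta>. max 0 (- X \<theta> - real n) \<partial>P) - (1 - a) * 0) < \<delta>" by blast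
    then have n: "(1 - a) * (\<integral>\<theta>. max 0 (- X \<theta> - real n) \<partial>P) < \<delta>" by simp
    have "(\<integral>\<theta>. max (a * (X \<theta> - - real n)) (b * (X \<theta> - - real n)) \<partial>P)
        = (\<integral>\<theta>. X \<theta> \<partial>P) + real n + (1 - a) * (\<integral>\<theta>. max 0 (- X \<theta> - real n) \<partial>P)"
      unfolding eq using X_integrable by (simp add: prob_space)
    then show ?thesis using that[of "- real n"] n mean_X by simp
  next
    \<comment> \<open>The mirror image, with \<mu> = n tending to infinity.\<close>
    case 3
    have eq: "max (a * y) (b * y) = y + (b - 1) * max 0 y" for y
      using one 3 mult_right_mono[of 1 b y] mult_right_mono_neg[of 1 b y]
      by (cases "0 \<le> y") (auto simp: max_def algebra_simps)
    have "(\<lambda>n. (b - 1) * (\<integral>\<theta>. max 0 (X \<theta> - real n) \<partial>P)) \<longlonglongrightarrow> (b - 1) * 0"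
      using X_integrable by (intro tendsto_mult_left truncated_mean_tendsto_0)
    from LIMSEQ_D[OF this \<delta>] obtain n
      where "norm ((b - 1) * (\<integral>\<theta>. max 0 (X \<theta> - real n) \<partial>P) - (b - 1) * 0) < \<delta>" by blast
    then have n: "(b - 1) * (\<integral>\<theta>. max 0 (X \<theta> - real n) \<partial>P) < \<delta>" by simp
    have "(\<integral>\<theta>. max (a * (X \<theta> - real n)) (b * (X \<theta> - real n)) \<partial>P)
        = (\<integral>\<theta>. X \<theta> \<partial>P) - real n + (b - 1) * (\<integral>\<theta>. max 0 (X \<theta> - real n) \<partial>P)"
      unfolding eq using X_integrable by (simp add: prob_space)
    then show ?thesis using that[of "real n"] n mean_X by simp
  qed
qed

section \<open>Optimal densities as optimal admissible functions\<close>

lemma density_of_admissible: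
  assumes q: "q \<in> admissible" and mean: "(\<integral>\<theta>. q \<theta> \<partial>P) = 1"
  obtains d where "d \<in> densities P" "pairing P (real_density d) X = pairing P q X"
    "divergence P \<phi> (real_density d) = ereal (mean_cost q)"
proof
  note [measurable] = admissibleD(1)[OF q]
  have nonneg: "AE \<theta> in P. 0 \<le> q \<theta>"
    using admissibleD(2)[OF q] by eventually_elim (rule dom_nonneg)
  have eq: "AE \<theta> in P. real_density (\<lambda>\<theta>. ennreal (q \<theta>)) \<theta> = q \<theta>"
    using nonneg by eventually_elim (simp add: real_density_def)
  show "(\<lambda>\<theta>. ennreal (q \<theta>)) \<in> densities P"
    using nn_integral_eq_integral[OF admissible_integrable(1)[OF q] nonneg] mean
    by (simp add: densities_def)
  have [measurable]: "real_density (\<lambda>\<theta>. ennreal (q \<theta>)) \<in> borel_measurable P"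
    unfolding real_density_def by measurable
  show "pairing P (real_density (\<lambda>\<theta>. ennreal (q \<theta>))) X = pairing P q X"
    unfolding pairing_def by (rule integral_cong_AE) (use eq in auto)
  have "divergence P \<phi> (real_density (\<lambda>\<theta>. ennreal (q \<theta>))) = divergence P \<phi> q"
    unfolding divergence_def by (rule ereal_expectation_cong_AE) (use eq in auto)
  then show "divergence P \<phi> (real_density (\<lambda>\<theta>. ennreal (q \<theta>))) = ereal (mean_cost q)"
    by (simp add: divergence_admissible[OF q])
qed

lemma real_density_measurable: "p \<in> densities P \<Longrightarrow> real_density p \<in> borel_measurable P"
  by (auto simp: densities_def real_density_def[abs_def])

lemma real_density_mean:
  assumes "p \<in> densities P"
  shows "(\<integral>\<theta>. real_density p \<theta> \<partial>P) = 1"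
proof -
  have [measurable]: "p \<in> borel_measurable P" and one: "(\<integral>\<^sup>+\<theta>. p \<theta> \<partial>P) = 1"
    using assms by (auto simp: densities_def)
  have "AE \<theta> in P. p \<theta> \<noteq> \<infinity>" using one by (intro nn_integral_PInf_AE) auto
  then have "AE \<theta> in P. ennreal (enn2real (p \<theta>)) = p \<theta>"
    by eventually_elim (simp add: less_top)
  then have "(\<integral>\<^sup>+\<theta>. ennreal (enn2real (p \<theta>)) \<partial>P) = 1"
    using one nn_integral_cong_AE by metis
  then show ?thesis
    unfolding real_density_def by (subst integral_eq_nn_integral) auto
qed

lemma gvi_optimal:
  assumes \<sigma>: "0 < \<sigma>" and gvi: "gvi_density P \<phi> \<sigma> X p"
  shows "real_density p \<in> admissible" "(\<integral>\<theta>. real_density p \<theta> \<partial>P) = 1"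
    and "\<And>q. q \<in> admissible \<Longrightarrow> (\<integral>\<theta>. q \<theta> \<partial>P) = 1 \<Longrightarrow>
      pairing P q X - \<sigma> * mean_cost q \<le> pairing P (real_density p) X - \<sigma> * mean_cost (real_density p)"
proof -
  have p: "p \<in> densities P"
    and max: "\<And>d. d \<in> densities P \<Longrightarrow> gvi_objective P \<phi> \<sigma> X d \<le> gvi_objective P \<phi> \<sigma> X p"
    using gvi by (auto simp: gvi_density_def is_arg_max_def not_less)
  have ge: "ereal (pairing P q X - \<sigma> * mean_cost q) \<le> gvi_objective P \<phi> \<sigma> X p"
    if q: "q \<in> admissible" "(\<integral>\<theta>. q \<theta> \<partial>P) = 1" for q
  proof -
    from q obtain d where "d \<in> densities P" "pairing P (real_density d) X = pairing P q X"
      "divergence P \<phi> (real_density d) = ereal (mean_cost q)" by (rule density_of_admissible)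
    then show ?thesis using max[of d] by (simp add: gvi_objective_def)
  qed
  \<comment> \<open>An infinite divergence would push the value of \<open>p\<close> to minus
    infinity, below the value of the density 1.\<close>
  have "divergence P \<phi> (real_density p) < \<infinity>"
  proof (rule ccontr)
    assume "\<not> ?thesis"
    then have "gvi_objective P \<phi> \<sigma> X p = - \<infinity>" using \<sigma> by (simp add: gvi_objective_def)
    then show False
      using ge[OF const_admissible[OF one_in_dom]] by (simp add: prob_space)
  qed
  then show adm: "real_density p \<in> admissible"
    by (rule admissible_if_divergence_finite[OF real_density_measurable[OF p]])
  show "(\<integral>\<theta>. real_density p \<theta> \<partial>P) = 1" by (rule real_density_mean[OF p])
  show "pairing P q X - \<sigma> * mean_cost q \<le> pairing P (real_density p) X - \<sigma> * mean_cost (real_density p)"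
    if "q \<in> admissible" "(\<integral>\<theta>. q \<theta> \<partial>P) = 1" for q
    using ge[OF that] by (simp add: gvi_objective_def divergence_admissible[OF adm])
qed

lemma cgvi_optimal:
  assumes cgvi: "cgvi_density P \<phi> \<epsilon> X p"
  shows "real_density p \<in> admissible" "(\<integral>\<theta>. real_density p \<theta> \<partial>P) = 1" "mean_cost (real_density p) \<le> \<epsilon>"
    and "\<And>q. q \<in> admissible \<Longrightarrow> (\<integral>\<theta>. q \<theta> \<partial>P) = 1 \<Longrightarrow> mean_cost q \<le> \<epsilon> \<Longrightarrow>
      pairing P q X \<le> pairing P (real_density p) X"
proof -
  have p: "p \<in> densities P" "divergence P \<phi> (real_density p) \<le> ereal \<epsilon>"
    and max: "\<And>d. d \<in> densities P \<Longrightarrow> divergence P \<phi> (real_density d) \<le> ereal \<epsilon> \<Longrightarrow>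
      pairing P (real_density d) X \<le> pairing P (real_density p) X"
    using cgvi by (auto simp: cgvi_density_def is_arg_max_def not_less)
  show adm: "real_density p \<in> admissible"
    using p by (intro admissible_if_divergence_finite real_density_measurable) auto
  show "(\<integral>\<theta>. real_density p \<theta> \<partial>P) = 1" by (rule real_density_mean[OF p(1)])
  show "mean_cost (real_density p) \<le> \<epsilon>"
    using p(2) by (simp add: divergence_admissible[OF adm])
  show "pairing P q X \<le> pairing P (real_density p) X"
    if q: "q \<in> admissible" "(\<integral>\<theta>. q \<theta> \<partial>P) = 1" and "mean_cost q \<le> \<epsilon>" for q
  proof -
    from q obtain d where "d \<in> densities P" "pairing P (real_density d) X = pairing P q X"
      "divergence P \<phi> (real_density d) = ereal (mean_cost q)" by (rule density_of_admissible)
    then show ?thesis using max[of d] \<open>mean_cost q \<le> \<epsilon>\<close> by simp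
  qed
qed

section \<open>The GVI problem\<close>

text \<open>The multiplier \<mu> only serves to show that the dual value is \<open>V\<close>. For
  any minimizer t, this leaves no room between \<open>v\<close> along X and its Young minorant
  \<open>g t\<close> built from the density.\<close>

lemma gvi_solution:
  assumes \<sigma>: "0 < \<sigma>" and gvi: "gvi_density P \<phi> \<sigma> X p"
  shows "\<exists>t. is_arg_min (gvi_dual P v \<sigma> X) (\<lambda>_. True) t"
    and "is_arg_min (gvi_dual P v \<sigma> X) (\<lambda>_. True) t \<Longrightarrow>
      AE \<theta> in P. real_density p \<theta> \<in> subdifferential v (inverse \<sigma> * (X \<theta> - t))"
proof -
  define r where "r = real_density p"
  note r = gvi_optimal[OF assms, folded r_def]
  note r_int = admissible_integrable[OF r(1)] admissibleD(3)[OF r(1)]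
  define V where "V = pairing P r X - \<sigma> * mean_cost r"
  define g where "g t \<theta> = r \<theta> * (inverse \<sigma> * (X \<theta> - t)) - cost (r \<theta>)" for t \<theta>
  have g_eq: "g t \<theta> = inverse \<sigma> * (r \<theta> * X \<theta> - t * r \<theta>) - cost (r \<theta>)" for t \<theta>
    by (simp add: g_def algebra_simps)
  have g_int: "integrable P (g t)" for t
    unfolding g_eq[abs_def] using r_int by auto
  have "(\<integral>\<theta>. g t \<theta> \<partial>P) = inverse \<sigma> * (pairing P r X - t) - mean_cost r" for t
    unfolding g_eq[abs_def] using r_int by (simp add: pairing_def r(2))
  \<comment> \<open>As \<open>r\<close> has mean 1, the shift by t cancels: every t gives the same
    value \<open>V\<close>.\<close>
  then have V: "V = t + \<sigma> * (\<integral>\<theta>. g t \<theta> \<partial>P)" for t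
    using \<sigma> by (simp add: V_def field_simps)
  have g_le: "AE \<theta> in P. ereal (g t \<theta>) \<le> v (inverse \<sigma> * (X \<theta> - t))" for t
    using admissibleD(2)[OF r(1)] by eventually_elim (simp add: g_def young)
  have dual_ge: "ereal V \<le> gvi_dual P v \<sigma> X t" for t
  proof -
    have "ereal (\<integral>\<theta>. g t \<theta> \<partial>P) \<le> ereal_expectation P (\<lambda>\<theta>. v (inverse \<sigma> * (X \<theta> - t)))"
      using ereal_expectation_mono_AE[OF g_le] by (simp add: ereal_expectation_ereal[OF g_int])
    then have "ereal \<sigma> * ereal (\<integral>\<theta>. g t \<theta> \<partial>P)
        \<le> ereal \<sigma> * ereal_expectation P (\<lambda>\<theta>. v (inverse \<sigma> * (X \<theta> - t)))"
      using \<sigma> by (intro ereal_mult_left_mono) auto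
    then have "ereal t + ereal \<sigma> * ereal (\<integral>\<theta>. g t \<theta> \<partial>P) \<le> gvi_dual P v \<sigma> X t"
      unfolding gvi_dual_def by (rule add_left_mono)
    then show ?thesis by (simp add: V[of t])
  qed
  obtain \<mu> where \<mu>: "\<And>q. q \<in> admissible \<Longrightarrow> pairing P q X - \<sigma> * mean_cost q - \<mu> * (\<integral>\<theta>. q \<theta> \<partial>P) \<le> V - \<mu>"
    using admissible_mean_multiplier[OF less_imp_le[OF \<sigma>] r(3)] unfolding V_def by blast
  have "AE \<theta> in P. \<forall>s\<in>dom. s * (X \<theta> - \<mu>) - \<sigma> * cost s \<le> r \<theta> * (X \<theta> - \<mu>) - \<sigma> * cost (r \<theta>)"
    using \<mu> \<sigma> by (intro optimal_imp_pointwise_optimal[OF r(1)]) (auto simp: r(2) V_def)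
  then have "AE \<theta> in P. v (inverse \<sigma> * (X \<theta> - \<mu>)) = ereal (g \<mu> \<theta>)"
    using admissibleD(2)[OF r(1)]
    by eventually_elim (use pointwise_optimal_imp_subdifferential(1)[OF \<sigma>] in \<open>auto simp: g_def\<close>)
  then have "ereal_expectation P (\<lambda>\<theta>. v (inverse \<sigma> * (X \<theta> - \<mu>))) = ereal (\<integral>\<theta>. g \<mu> \<theta> \<partial>P)"
    using ereal_expectation_cong_AE ereal_expectation_ereal[OF g_int] by metis
  then have dual_eq: "gvi_dual P v \<sigma> X \<mu> = ereal V"
    by (simp add: gvi_dual_def V[of \<mu>])
  then show "\<exists>t. is_arg_min (gvi_dual P v \<sigma> X) (\<lambda>_. True) t"
    unfolding is_arg_min_def not_less by (metis dual_ge not_less)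
  assume "is_arg_min (gvi_dual P v \<sigma> X) (\<lambda>_. True) t"
  then have "gvi_dual P v \<sigma> X t \<le> ereal V"
    unfolding dual_eq[symmetric] by (auto simp: is_arg_min_def not_less)
  then have "ereal_expectation P (\<lambda>\<theta>. v (inverse \<sigma> * (X \<theta> - t))) \<le> ereal (\<integral>\<theta>. g t \<theta> \<partial>P)"
    unfolding gvi_dual_def V[of t] using \<sigma>
    by (cases "ereal_expectation P (\<lambda>\<theta>. v (inverse \<sigma> * (X \<theta> - t)))") auto
  then have "AE \<theta> in P. v (inverse \<sigma> * (X \<theta> - t)) = ereal (g t \<theta>)"
    by (intro ereal_expectation_le_imp_AE_eq[OF g_int _ g_le]) auto
  then show "AE \<theta> in P. real_density p \<theta> \<in> subdifferential v (inverse \<sigma> * (X \<theta> - t))"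
    using admissibleD(2)[OF r(1)]
    by eventually_elim (auto simp: g_def r_def intro: conj_eq_imp_subdifferential)
qed

section \<open>The CGVI problem\<close>

text \<open>The dual enters only through comparison with real bounds, where its supremum is a family
  of Lagrangian inequalities. Functions of infinite divergence contribute minus infinity, also for l
  = 0 thanks to the convention in \<open>scale\<close>.\<close>

lemma cgvi_dual_le_iff:
  "cgvi_dual P \<phi> \<epsilon> X (l, \<mu>) \<le> ereal W \<longleftrightarrow>
    (\<forall>q\<in>admissible. pairing P q X - l * mean_cost q - \<mu> * (\<integral>\<theta>. q \<theta> \<partial>P) \<le> W - \<mu> - l * \<epsilon>)"
    (is "_ \<longleftrightarrow> ?R")
proof -
  let ?S = "scaled_divergence_conj P \<phi> l (\<lambda>\<theta>. X \<theta> - \<mu>)"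
  have "cgvi_dual P \<phi> \<epsilon> X (l, \<mu>) \<le> ereal W \<longleftrightarrow> ?S \<le> ereal (W - \<mu> - l * \<epsilon>)"
    unfolding cgvi_dual_def by (cases ?S) auto
  also have "\<dots> \<longleftrightarrow> ?R"
    unfolding scaled_divergence_conj_def SUP_le_iff
  proof (intro iffI ballI)
    fix q
    assume le: "\<forall>p\<in>L_space P \<phi>. ereal (pairing P p (\<lambda>\<theta>. X \<theta> - \<mu>)) - scale l (divergence P \<phi> p)
      \<le> ereal (W - \<mu> - l * \<epsilon>)" and q: "q \<in> admissible"
    from le[rule_format, OF admissible_in_L_space[OF q]]
    show "pairing P q X - l * mean_cost q - \<mu> * (\<integral>\<theta>. q \<theta> \<partial>P) \<le> W - \<mu> - l * \<epsilon>"
      by (simp add: pairing_shift[OF q] divergence_admissible[OF q] scale_def)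
  next
    fix q assume R: ?R and q: "q \<in> L_space P \<phi>"
    show "ereal (pairing P q (\<lambda>\<theta>. X \<theta> - \<mu>)) - scale l (divergence P \<phi> q) \<le> ereal (W - \<mu> - l * \<epsilon>)"
    proof (cases "divergence P \<phi> q < \<infinity>")
      case True
      then have "q \<in> admissible"
        using q by (intro admissible_if_divergence_finite) (auto simp: orlicz_space_def)
      then show ?thesis
        using R by (force simp: pairing_shift divergence_admissible scale_def)
    qed (simp add: scale_def)
  qed
  finally show ?thesis .
qed

lemma cgvi_multipliers:
  assumes \<epsilon>: "0 < \<epsilon>"
    and opt: "\<And>q. q \<in> admissible \<Longrightarrow> (\<integral>\<theta>. q \<theta> \<partial>P) = 1 \<Longrightarrow> mean_cost q \<le> \<epsilon> \<Longrightarrow> pairing P q X \<le> V"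
    and r: "r \<in> admissible" "(\<integral>\<theta>. r \<theta> \<partial>P) = 1" "mean_cost r \<le> \<epsilon>" "pairing P r X = V"
  obtains l \<mu> where "0 \<le> l" "cgvi_dual P \<phi> \<epsilon> X (l, \<mu>) \<le> ereal V"
proof -
  \<comment> \<open>Here the value is affine and the cost only convex; allowing any budget
    \<open>c\<close> above the mean cost restores convexity.\<close>
  define C where "C = {(c, pairing P q X) | c q. q \<in> admissible \<and> (\<integral>\<theta>. q \<theta> \<partial>P) = 1 \<and> mean_cost q \<le> c}"
  have CI: "(c, pairing P q X) \<in> C" if "q \<in> admissible" "(\<integral>\<theta>. q \<theta> \<partial>P) = 1" "mean_cost q \<le> c" for c q
    using that by (auto simp: C_def)
  have "convex C"
    unfolding convex_alt
  proof (intro ballI allI impI)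
    fix x y and u :: real
    assume "x \<in> C" "y \<in> C" and u: "0 \<le> u \<and> u \<le> 1"
    then obtain c p d q where x: "x = (c, pairing P p X)" and y: "y = (d, pairing P q X)"
      and pq: "p \<in> admissible" "q \<in> admissible" "(\<integral>\<theta>. p \<theta> \<partial>P) = 1" "(\<integral>\<theta>. q \<theta> \<partial>P) = 1"
      "mean_cost p \<le> c" "mean_cost q \<le> d"
      by (auto simp: C_def)
    let ?m = "\<lambda>\<theta>. (1 - u) * p \<theta> + u * q \<theta>"
    have "mean_cost ?m \<le> (1 - u) * mean_cost p + u * mean_cost q"
      using admissible_convex(2)[OF pq(1,2)] u by auto
    also have "\<dots> \<le> (1 - u) * c + u * d"
      using pq u by (intro add_mono mult_left_mono) auto
    finally have "((1 - u) * c + u * d, pairing P ?m X) \<in> C"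
      using admissible_convex(1)[OF pq(1,2)] u integral_convex_combination(1)[OF pq(1,2), of u] pq(3,4)
      by (intro CI) auto
    then show "(1 - u) *\<^sub>R x + u *\<^sub>R y \<in> C"
      unfolding x y using integral_convex_combination(2)[OF pq(1,2)] by simp
  qed
  moreover have "s \<le> V" if "(\<epsilon>, s) \<in> C" for s
    using that opt by (auto simp: C_def)
  \<comment> \<open>The constant 1 costs nothing and is the Slater point, as \<epsilon> > 0.\<close>
  moreover have "(0, (\<integral>\<theta>. X \<theta> \<partial>P)) \<in> C"
    using CI[OF const_admissible[OF one_in_dom], of 0] by (simp add: prob_space cost_one pairing_def)
  \<comment> \<open>A larger budget still achieves \<open>V\<close>, which provides a point to the
    right of \<epsilon> and forces the slope \<open>l\<close> to be nonnegative.\<close>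
  moreover have rC: "(\<epsilon> + 1, V) \<in> C"
    using CI[OF r(1,2), of "\<epsilon> + 1"] r(3,4) by simp
  ultimately obtain l where l: "\<And>c s. (c, s) \<in> C \<Longrightarrow> s \<le> V + l * (c - \<epsilon>)"
    using supporting_slope[of C \<epsilon> V] \<epsilon> by (metis less_add_one)
  have "0 \<le> l" using l[OF rC] by simp
  have opt': "pairing P q X - l * mean_cost q \<le> V - l * \<epsilon>"
    if "q \<in> admissible" "(\<integral>\<theta>. q \<theta> \<partial>P) = 1" for q
    using l[OF CI[OF that order_refl]] by (simp add: algebra_simps)
  obtain \<mu> where \<mu>: "\<And>q. q \<in> admissible \<Longrightarrow>
      pairing P q X - l * mean_cost q - \<mu> * (\<integral>\<theta>. q \<theta> \<partial>P) \<le> V - l * \<epsilon> - \<mu>"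
    using admissible_mean_multiplier[OF \<open>0 \<le> l\<close> opt'] by blast
  have "cgvi_dual P \<phi> \<epsilon> X (l, \<mu>) \<le> ereal V"
    unfolding cgvi_dual_le_iff using \<mu> by (auto simp: algebra_simps)
  with \<open>0 \<le> l\<close> that show ?thesis by blast
qed

lemma cgvi_no_gap:
  assumes \<epsilon>: "0 \<le> \<epsilon>" and \<delta>: "0 < \<delta>"
    and opt: "\<And>q. q \<in> admissible \<Longrightarrow> (\<integral>\<theta>. q \<theta> \<partial>P) = 1 \<Longrightarrow> mean_cost q \<le> \<epsilon> \<Longrightarrow> pairing P q X \<le> V"
    and r: "r \<in> admissible" "(\<integral>\<theta>. r \<theta> \<partial>P) = 1" "mean_cost r \<le> \<epsilon>" "pairing P r X = V"
  obtains l \<mu> where "0 \<le> l" "cgvi_dual P \<phi> \<epsilon> X (l, \<mu>) \<le> ereal (V + \<delta>)"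
proof (cases "\<epsilon> = 0")
  case False
  with \<epsilon> have "0 < \<epsilon>" by simp
  from cgvi_multipliers[OF this opt r] obtain l \<mu>
    where "0 \<le> l" "cgvi_dual P \<phi> \<epsilon> X (l, \<mu>) \<le> ereal V" by blast
  moreover have "ereal V \<le> ereal (V + \<delta>)" using \<delta> by simp
  ultimately show ?thesis using that order_trans by blast
next
  case True
  obtain a b where Z: "{s \<in> dom. cost s = 0} = {a..b}" by (rule zero_cost_interval)
  \<comment> \<open>One half pays for a nearly optimal \<mu>, the other for a finite
    \<open>l\<close>.\<close>
  have \<delta>2: "0 < \<delta> / 2" using \<delta> by simp
  obtain \<mu> where \<mu>: "(\<integral>\<theta>. max (a * (X \<theta> - \<mu>)) (b * (X \<theta> - \<mu>)) \<partial>P) \<le> V - \<mu> + \<delta> / 2"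
    using zero_cost_dual[OF Z \<delta>2, of V] opt True by auto
  obtain l where l: "0 < l" "\<And>q. q \<in> admissible \<Longrightarrow>
    pairing P q X - l * mean_cost q - \<mu> * (\<integral>\<theta>. q \<theta> \<partial>P)
      \<le> (\<integral>\<theta>. max (a * (X \<theta> - \<mu>)) (b * (X \<theta> - \<mu>)) \<partial>P) + \<delta> / 2"
    using perspective_integral_bound[OF Z \<delta>2, of \<mu>] by blast
  have "cgvi_dual P \<phi> \<epsilon> X (l, \<mu>) \<le> ereal (V + \<delta>)"
    unfolding cgvi_dual_le_iff using l(2) \<mu> True by force
  with l(1) that show ?thesis by (meson less_imp_le)
qed

text \<open>The minimizer is handled through its value alone: \<open>cgvi_no_gap\<close> puts it
  below V + \<delta> for every \<delta>, hence below \<open>V\<close>. Positivity of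
  \<open>l\<close> enters when the Lagrangian is divided by it.\<close>

lemma cgvi_solution:
  assumes \<epsilon>: "0 \<le> \<epsilon>" and cgvi: "cgvi_density P \<phi> \<epsilon> X p"
  shows "0 < \<epsilon> \<Longrightarrow> \<exists>l \<mu>. is_arg_min (cgvi_dual P \<phi> \<epsilon> X) (\<lambda>(l, \<mu>). l \<ge> 0) (l, \<mu>)"
    and "is_arg_min (cgvi_dual P \<phi> \<epsilon> X) (\<lambda>(l, \<mu>). l \<ge> 0) (l, \<mu>) \<Longrightarrow> 0 < l \<Longrightarrow>
      AE \<theta> in P. real_density p \<theta> \<in> subdifferential v (inverse l * (X \<theta> - \<mu>))"
proof -
  define r where "r = real_density p"
  note r = cgvi_optimal[OF cgvi, folded r_def]
  define V where "V = pairing P r X"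
  \<comment> \<open>Weak duality, by testing the dual bound with the optimal density.\<close>
  have dual_ge: "ereal V \<le> cgvi_dual P \<phi> \<epsilon> X (l, \<mu>)" if l: "0 \<le> l" for l \<mu>
  proof (rule ereal_le_real)
    fix W assume "cgvi_dual P \<phi> \<epsilon> X (l, \<mu>) \<le> ereal W"
    then have "V - l * mean_cost r - \<mu> \<le> W - \<mu> - l * \<epsilon>"
      unfolding cgvi_dual_le_iff using r(1,2) by (force simp: V_def)
    with mult_left_mono[OF r(3) l] show "ereal V \<le> ereal W" by simp
  qed
  show "\<exists>l \<mu>. is_arg_min (cgvi_dual P \<phi> \<epsilon> X) (\<lambda>(l, \<mu>). l \<ge> 0) (l, \<mu>)" if \<epsilon>_pos: "0 < \<epsilon>"
  proof -
    obtain l \<mu> where l: "0 \<le> l" "cgvi_dual P \<phi> \<epsilon> X (l, \<mu>) \<le> ereal V"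
      using cgvi_multipliers[OF \<epsilon>_pos r(4,1,2,3)] V_def by blast
    have "cgvi_dual P \<phi> \<epsilon> X (l, \<mu>) \<le> cgvi_dual P \<phi> \<epsilon> X (l', \<mu>')" if "0 \<le> l'" for l' \<mu>'
      using l(2) dual_ge[OF that] by (rule order_trans)
    then have "is_arg_min (cgvi_dual P \<phi> \<epsilon> X) (\<lambda>(l, \<mu>). l \<ge> 0) (l, \<mu>)"
      using l(1) by (auto simp: is_arg_min_def not_less)
    then show ?thesis by blast
  qed
  assume min: "is_arg_min (cgvi_dual P \<phi> \<epsilon> X) (\<lambda>(l, \<mu>). l \<ge> 0) (l, \<mu>)" and l: "0 < l"
  have "cgvi_dual P \<phi> \<epsilon> X (l, \<mu>) \<le> ereal V + ereal \<delta>" if \<delta>: "0 < \<delta>" for \<delta>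
  proof -
    obtain l' \<mu>' where "0 \<le> l'" "cgvi_dual P \<phi> \<epsilon> X (l', \<mu>') \<le> ereal (V + \<delta>)"
      using cgvi_no_gap[OF \<epsilon> \<delta> r(4,1,2,3)] V_def by blast
    moreover from this have "cgvi_dual P \<phi> \<epsilon> X (l, \<mu>) \<le> cgvi_dual P \<phi> \<epsilon> X (l', \<mu>')"
      using min by (auto simp: is_arg_min_def not_less)
    ultimately show ?thesis by simp
  qed
  then have "cgvi_dual P \<phi> \<epsilon> X (l, \<mu>) \<le> ereal V"
    by (rule ereal_le_epsilon2)
  then have dual: "pairing P q X - l * mean_cost q - \<mu> * (\<integral>\<theta>. q \<theta> \<partial>P) \<le> V - \<mu> - l * \<epsilon>"
    if "q \<in> admissible" for q
    unfolding cgvi_dual_le_iff using that by blast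
  \<comment> \<open>Feasibility turns the bound \<open>V - \<mu> - l * \<epsilon>\<close> into the
    Lagrangian value at \<open>r\<close>, so \<open>r\<close> is an unconstrained maximizer.\<close>
  have "l * mean_cost r \<le> l * \<epsilon>" using r(3) l by simp
  then have "pairing P q X - l * mean_cost q - \<mu> * (\<integral>\<theta>. q \<theta> \<partial>P)
      \<le> pairing P r X - l * mean_cost r - \<mu> * (\<integral>\<theta>. r \<theta> \<partial>P)" if "q \<in> admissible" for q
    using dual[OF that] by (simp add: V_def r(2))
  from optimal_imp_pointwise_optimal[OF r(1) less_imp_le[OF l] this]
  have "AE \<theta> in P. \<forall>s\<in>dom. s * (X \<theta> - \<mu>) - l * cost s \<le> r \<theta> * (X \<theta> - \<mu>) - l * cost (r \<theta>)" .
  then show "AE \<theta> in P. real_density p \<theta> \<in> subdifferential v (inverse l * (X \<theta> - \<mu>))"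
    using admissibleD(2)[OF r(1)] unfolding r_def
    by eventually_elim (use pointwise_optimal_imp_subdifferential(2)[OF l] in auto)
qed

end

theorem theorem16:
  fixes P :: "'a measure"
    and \<phi> v :: "real \<Rightarrow> ereal"
    and m :: "'a \<Rightarrow> 'y \<Rightarrow> real" and y :: "nat \<Rightarrow> 'y" and N :: nat
    and X :: "'a \<Rightarrow> real"
    and \<sigma> \<epsilon> :: real
  assumes "prob_space P" and "complete_measure P"
    and "proper_closed_convex \<phi>" and "\<And>t. 0 \<le> \<phi> t" and "\<phi> 1 = 0" and "\<And>t. t < 0 \<Longrightarrow> \<phi> t = \<infinity>"
    and "v = fenchel_conj \<phi>"
    and "risk_averse_disutility v" and "\<exists>t>0. v t < \<infinity>"
    and "N \<ge> 1" and "X = payoff m y N" and "X \<in> M_space P \<phi>"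
    and "\<sigma> > 0" and "\<epsilon> \<ge> 0"
  shows
    "(\<forall>p. gvi_density P \<phi> \<sigma> X p \<and> real_density p \<in> L_space P \<phi> \<longrightarrow>
        (\<exists>t. is_arg_min (gvi_dual P v \<sigma> X) (\<lambda>_. True) t) \<and>
        (\<forall>t. is_arg_min (gvi_dual P v \<sigma> X) (\<lambda>_. True) t \<longrightarrow>
           (AE \<theta> in P. real_density p \<theta> \<in> subdifferential v (inverse \<sigma> * (X \<theta> - t)))))
     \<and>
     (\<forall>p. cgvi_density P \<phi> \<epsilon> X p \<and> real_density p \<in> L_space P \<phi> \<longrightarrow>
        (\<epsilon> > 0 \<longrightarrow> (\<exists>l \<mu>. is_arg_min (cgvi_dual P \<phi> \<epsilon> X) (\<lambda>(l, \<mu>). l \<ge> 0) (l, \<mu>))) \<and>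
        (\<forall>l \<mu>. is_arg_min (cgvi_dual P \<phi> \<epsilon> X) (\<lambda>(l, \<mu>). l \<ge> 0) (l, \<mu>) \<and> l > 0 \<longrightarrow>
           (AE \<theta> in P. real_density p \<theta> \<in> subdifferential v (inverse l * (X \<theta> - \<mu>)))))"
proof -
  interpret prob_space P by fact
  interpret variational_problem P \<phi> X
    using assms(3-9,12) by unfold_locales auto
  show ?thesis
    unfolding \<open>v = fenchel_conj \<phi>\<close>
    using gvi_solution[OF \<open>\<sigma> > 0\<close>] cgvi_solution[OF \<open>\<epsilon> \<ge> 0\<close>] by blast
qed

end
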